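(* Let $A$ be a residuated lattice, let $\mathcal{L}(A)$ be its reticulation, let $\tilde{A}$ be the strongly co-Stone hull of $A$, let $\mathcal{L}(\tilde{A})$ be the reticulation of $\tilde{A}$, and let $\widetilde{\mathcal{L}(A)}$ be the strongly co-Stone hull of the bounded distributive lattice $\mathcal{L}(A)$. Then $\mathcal{L}(\tilde{A})$ and $\widetilde{\mathcal{L}(A)}$ are isomorphic bounded lattices.
   Context: A residuated lattice is an algebra $(A,\vee,\wedge,\odot,\rightarrow,0,1)$ such that $(A,\vee,\wedge,0,1)$ is a bounded lattice, $(A,\odot,1)$ is a commutative monoid, and $a\leq b\rightarrow c$ iff $a\odot b\leq c$ for all $a,b,c\in A$. $a^n$ is the $n$-fold $\odot$-product of $a$. A reticulation of $A$ is a pair $(\mathcal{L}(A),\lambda)$ with $\mathcal{L}(A)$ a bounded distributive lattice and $\lambda:A\to\mathcal{L}(A)$ a surjective function such that for all $a,b\in A$: $\lambda(a\odot b)=\lambda(a)\wedge\lambda(b)$; $\lambda(a\vee b)=\lambda(a)\vee\lambda(b)$; $\lambda(0)=0$, $\lambda(1)=1$; and $\lambda(a)\leq\lambda(b)$ iff $a^n\leq b$ for some integer $n\geq 1$. A reticulation exists and is unique up to isomorphism (compatible with $\lambda$). A filter of a lattice (respectively residuated lattice) is a non-empty upward closed subset closed under $\wedge$ (respectively $\odot$). For a filter $F$ of a residuated lattice $M$, $M/F$ is the quotient by the congruence $a\equiv b$ iff $(a\rightarrow b)\wedge(b\rightarrow a)\in F$; for a filter $F$ of a bounded distributive lattice $M$,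 $M/F$ is the quotient by the congruence $a\equiv b$ iff $a\wedge e=b\wedge e$ for some $e\in F$. The class of $a$ is written $a/F$. Construction of the strongly co-Stone hull $\tilde{M}$, for $M$ a residuated lattice or a bounded distributive lattice: for $X\subseteq M$, $X^{\top}=\{a\in M\mid a\vee x=1\text{ for all }x\in X\}$ (a filter). $\mathrm{CoAnn}(M)=\{X^{\top}\mid X\subseteq M\}$ is a complete Boolean algebra under inclusion, with meet $\cap$, complement $F\mapsto F^{\top}$, least element $\{1\}$, greatest element $M$, and join $\bigvee^{\top}_{t}F_t=(\bigcap_t F_t^{\top})^{\top}$. $\Pi(M)$ is the set of finite partitions of $\mathrm{CoAnn}(M)$, i.e. finite sets $\mathcal{C}$ of elements of $\mathrm{CoAnn}(M)\setminus\{\{1\}\}$, pairwise with intersection $\{1\}$, and with join $M$ (the empty partition occurs only when $M$ is trivial). Order: $\mathcal{C}\leq\mathcal{D}$ iff $\mathcal{D}$ refines $\mathcal{C}$, i.e. every $D\in\mathcal{D}$ is contained in a (necessarily unique) $C\in\mathcal{C}$; $\Pi(M)$ is directed. Put $M_{\mathcal{C}}=\prod_{C\in\mathcal{C}}M/C^{\top}$, and for $\mathcal{C}\leq\mathcal{D}$ let $\mathcal{P}_{\mathcal{C}\mathcal{D}}:M_{\mathcal{C}}\to M_{\mathcal{D}}$ send $(a_C/C^{\top})_{C\in\mathcal{C}}$ to $(b_D/D^{\top})_{D\in\mathcal{D}}$ with $b_D=a_C$ for the unique $C\in\mathcal{C}$ with $D\subseteq C$. These morphisms form an inductive system, and $\tilde{M}=\varinjlim_{\mathcal{C}\in\Pi(M)}M_{\mathcal{C}}$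 (direct limit in the category of residuated lattices, respectively of bounded distributive lattices). *)

theory Defs
  imports "HOL-Algebra.Group"
begin

section \<open>Bounded lattices and residuated lattices as algebras on a carrier\<close>

text \<open>
  The lattice operations are part of the structure (as opposed to the order-based lattices of
  HOL-Algebra), since quotients, products and direct limits below are formed operation by operation.
\<close>

no_notation Lattice.join (infixl "\<squnion>\<index>" 65)
no_notation Lattice.meet (infixl "\<sqinter>\<index>" 70)

record 'a lat = "'a partial_object" +
  lsup :: "'a \<Rightarrow> 'a \<Rightarrow> 'a"  (infixl "\<squnion>\<index>" 65)
  linf :: "'a \<Rightarrow> 'a \<Rightarrow> 'a"  (infixl "\<sqinter>\<index>" 70)
  lzero :: 'a
  lone :: 'a

record 'a rlat = "'a lat" +
  rmult :: "'a \<Rightarrow> 'a \<Rightarrow> 'a"  (infixl "\<odot>\<index>" 70)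
  rimp :: "'a \<Rightarrow> 'a \<Rightarrow> 'a"  (infixr "\<leadsto>\<index>" 60)

definition lat_le :: "('a, 'm) lat_scheme \<Rightarrow> 'a \<Rightarrow> 'a \<Rightarrow> bool"  (infix "\<preceq>\<index>" 50) where
  "a \<preceq>\<^bsub>M\<^esub> b \<longleftrightarrow> a \<sqinter>\<^bsub>M\<^esub> b = a"

locale bounded_lattice_alg =
  fixes M :: "('a, 'm) lat_scheme" (structure)
  assumes sup_closed: "\<lbrakk>a \<in> carrier M; b \<in> carrier M\<rbrakk> \<Longrightarrow> a \<squnion> b \<in> carrier M"
    and inf_closed: "\<lbrakk>a \<in> carrier M; b \<in> carrier M\<rbrakk> \<Longrightarrow> a \<sqinter> b \<in> carrier M"
    and zero_closed: "lzero M \<in> carrier M"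
    and one_closed: "lone M \<in> carrier M"
    and sup_assoc: "\<lbrakk>a \<in> carrier M; b \<in> carrier M; c \<in> carrier M\<rbrakk>
          \<Longrightarrow> (a \<squnion> b) \<squnion> c = a \<squnion> (b \<squnion> c)"
    and inf_assoc: "\<lbrakk>a \<in> carrier M; b \<in> carrier M; c \<in> carrier M\<rbrakk>
          \<Longrightarrow> (a \<sqinter> b) \<sqinter> c = a \<sqinter> (b \<sqinter> c)"
    and sup_comm: "\<lbrakk>a \<in> carrier M; b \<in> carrier M\<rbrakk> \<Longrightarrow> a \<squnion> b = b \<squnion> a"
    and inf_comm: "\<lbrakk>a \<in> carrier M; b \<in> carrier M\<rbrakk> \<Longrightarrow> a \<sqinter> b = b \<sqinter> a"
    and sup_inf_absorb: "\<lbrakk>a \<in> carrier M; b \<in> carrier M\<rbrakk> \<Longrightarrow> a \<squnion> (a \<sqinter> b) = a"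
    and inf_sup_absorb: "\<lbrakk>a \<in> carrier M; b \<in> carrier M\<rbrakk> \<Longrightarrow> a \<sqinter> (a \<squnion> b) = a"
    and zero_least: "a \<in> carrier M \<Longrightarrow> lzero M \<preceq> a"
    and one_greatest: "a \<in> carrier M \<Longrightarrow> a \<preceq> lone M"

locale bounded_distrib_lattice_alg = bounded_lattice_alg +
  assumes inf_sup_distrib: "\<lbrakk>a \<in> carrier M; b \<in> carrier M; c \<in> carrier M\<rbrakk>
          \<Longrightarrow> a \<sqinter> (b \<squnion> c) = (a \<sqinter> b) \<squnion> (a \<sqinter> c)"

definition mult_monoid :: "('a, 'm) rlat_scheme \<Rightarrow> 'a monoid" where
  "mult_monoid A = \<lparr>carrier = carrier A, mult = rmult A, one = lone A\<rparr>"

locale residuated_lattice = bounded_lattice_alg A + mult: comm_monoid "mult_monoid A"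
  for A :: "('a, 'm) rlat_scheme" (structure) +
  assumes imp_closed: "\<lbrakk>a \<in> carrier A; b \<in> carrier A\<rbrakk> \<Longrightarrow> a \<leadsto> b \<in> carrier A"
    and residuation: "\<lbrakk>a \<in> carrier A; b \<in> carrier A; c \<in> carrier A\<rbrakk>
          \<Longrightarrow> a \<preceq> b \<leadsto> c \<longleftrightarrow> a \<odot> b \<preceq> c"

definition lat_iso :: "('a, 'm) lat_scheme \<Rightarrow> ('b, 'n) lat_scheme \<Rightarrow> ('a \<Rightarrow> 'b) set" where
  "lat_iso L K = {h. bij_betw h (carrier L) (carrier K) \<and>
     (\<forall>a\<in>carrier L. \<forall>b\<in>carrier L. h (a \<squnion>\<^bsub>L\<^esub> b) = h a \<squnion>\<^bsub>K\<^esub> h b) \<and>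
     (\<forall>a\<in>carrier L. \<forall>b\<in>carrier L. h (a \<sqinter>\<^bsub>L\<^esub> b) = h a \<sqinter>\<^bsub>K\<^esub> h b) \<and>
     h (lzero L) = lzero K \<and> h (lone L) = lone K}"

definition isomorphic_bounded_lattices ::
    "('a, 'm) lat_scheme \<Rightarrow> ('b, 'n) lat_scheme \<Rightarrow> bool" where
  "isomorphic_bounded_lattices L K \<longleftrightarrow> lat_iso L K \<noteq> {}"


section \<open>Reticulations\<close>

locale reticulation = L: bounded_distrib_lattice_alg L
  for A :: "('a, 'm) rlat_scheme" and L :: "('b, 'n) lat_scheme" and lam :: "'a \<Rightarrow> 'b" +
  assumes surj: "lam ` carrier A = carrier L"
    and map_mult: "\<lbrakk>a \<in> carrier A; b \<in> carrier A\<rbrakk>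
          \<Longrightarrow> lam (a \<odot>\<^bsub>A\<^esub> b) = lam a \<sqinter>\<^bsub>L\<^esub> lam b"
    and map_sup: "\<lbrakk>a \<in> carrier A; b \<in> carrier A\<rbrakk>
          \<Longrightarrow> lam (a \<squnion>\<^bsub>A\<^esub> b) = lam a \<squnion>\<^bsub>L\<^esub> lam b"
    and map_zero: "lam (lzero A) = lzero L"
    and map_one: "lam (lone A) = lone L"
    and map_le_iff: "\<lbrakk>a \<in> carrier A; b \<in> carrier A\<rbrakk> \<Longrightarrow> lam a \<preceq>\<^bsub>L\<^esub> lam b \<longleftrightarrow>
          (\<exists>n::nat. n \<ge> 1 \<and> a [^]\<^bsub>mult_monoid A\<^esub> n \<preceq>\<^bsub>A\<^esub> b)"


section \<open>Quotients, products and direct limits\<close>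

definition quot_op :: "('a \<times> 'a) set \<Rightarrow> ('a \<Rightarrow> 'a \<Rightarrow> 'a) \<Rightarrow> 'a set \<Rightarrow> 'a set \<Rightarrow> 'a set" where
  "quot_op r f X Y = (\<Union>x\<in>X. \<Union>y\<in>Y. r `` {f x y})"

definition lat_quot :: "('a, 'm) lat_scheme \<Rightarrow> ('a \<times> 'a) set \<Rightarrow> 'a set lat" where
  "lat_quot M r = \<lparr>carrier = carrier M // r, lsup = quot_op r (lsup M), linf = quot_op r (linf M),
     lzero = r `` {lzero M}, lone = r `` {lone M}\<rparr>"

definition rlat_quot :: "('a, 'm) rlat_scheme \<Rightarrow> ('a \<times> 'a) set \<Rightarrow> 'a set rlat" where
  "rlat_quot M r = lat.extend (lat_quot M r)
     (rlat.fields (quot_op r (rmult M)) (quot_op r (rimp M)))"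

definition prod_op :: "'i set \<Rightarrow> ('i \<Rightarrow> 'a \<Rightarrow> 'a \<Rightarrow> 'a) \<Rightarrow> ('i \<Rightarrow> 'a) \<Rightarrow> ('i \<Rightarrow> 'a) \<Rightarrow> 'i \<Rightarrow> 'a" where
  "prod_op I f x y = (\<lambda>i\<in>I. f i (x i) (y i))"

definition lat_prod :: "'i set \<Rightarrow> ('i \<Rightarrow> ('a, 'm) lat_scheme) \<Rightarrow> ('i \<Rightarrow> 'a) lat" where
  "lat_prod I M = \<lparr>carrier = (\<Pi>\<^sub>E i\<in>I. carrier (M i)),
     lsup = prod_op I (\<lambda>i. lsup (M i)), linf = prod_op I (\<lambda>i. linf (M i)),
     lzero = (\<lambda>i\<in>I. lzero (M i)), lone = (\<lambda>i\<in>I. lone (M i))\<rparr>"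

definition rlat_prod :: "'i set \<Rightarrow> ('i \<Rightarrow> ('a, 'm) rlat_scheme) \<Rightarrow> ('i \<Rightarrow> 'a) rlat" where
  "rlat_prod I M = lat.extend (lat_prod I M)
     (rlat.fields (prod_op I (\<lambda>i. rmult (M i))) (prod_op I (\<lambda>i. rimp (M i))))"

text \<open>
  The direct limit of a directed system, with transition maps \<open>\<phi> i j\<close> for \<open>leq i j\<close>, is
  the disjoint union of the stages modulo eventual equality.  An operation is applied to two
  classes by choosing representatives at a common stage; all choices give the same class,
  so the union below is that class.
\<close>

definition dlim_rel :: "'i set \<Rightarrow> ('i \<Rightarrow> 'i \<Rightarrow> bool) \<Rightarrow> ('i \<Rightarrow> ('a, 'm) partial_object_scheme) \<Rightarrow>
    ('i \<Rightarrow> 'i \<Rightarrow> 'a \<Rightarrow> 'a) \<Rightarrow> (('i \<times> 'a) \<times> ('i \<times> 'a)) set" where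
  "dlim_rel I leq M \<phi> = {((i, x), (j, y)). i \<in> I \<and> x \<in> carrier (M i) \<and> j \<in> I \<and> y \<in> carrier (M j) \<and>
     (\<exists>k\<in>I. leq i k \<and> leq j k \<and> \<phi> i k x = \<phi> j k y)}"

definition dlim_op :: "(('i \<times> 'a) \<times> ('i \<times> 'a)) set \<Rightarrow> ('i \<Rightarrow> 'a \<Rightarrow> 'a \<Rightarrow> 'a) \<Rightarrow>
    ('i \<times> 'a) set \<Rightarrow> ('i \<times> 'a) set \<Rightarrow> ('i \<times> 'a) set" where
  "dlim_op r f X Y = \<Union>{r `` {(k, f k x y)} | k x y. (k, x) \<in> X \<and> (k, y) \<in> Y}"

definition lat_dlim :: "'i set \<Rightarrow> ('i \<Rightarrow> 'i \<Rightarrow> bool) \<Rightarrow> ('i \<Rightarrow> ('a, 'm) lat_scheme) \<Rightarrow>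
    ('i \<Rightarrow> 'i \<Rightarrow> 'a \<Rightarrow> 'a) \<Rightarrow> ('i \<times> 'a) set lat" where
  "lat_dlim I leq M \<phi> = (let r = dlim_rel I leq M \<phi> in
     \<lparr>carrier = (SIGMA i:I. carrier (M i)) // r,
      lsup = dlim_op r (\<lambda>i. lsup (M i)), linf = dlim_op r (\<lambda>i. linf (M i)),
      lzero = (\<Union>i\<in>I. r `` {(i, lzero (M i))}), lone = (\<Union>i\<in>I. r `` {(i, lone (M i))})\<rparr>)"

definition rlat_dlim :: "'i set \<Rightarrow> ('i \<Rightarrow> 'i \<Rightarrow> bool) \<Rightarrow> ('i \<Rightarrow> ('a, 'm) rlat_scheme) \<Rightarrow>
    ('i \<Rightarrow> 'i \<Rightarrow> 'a \<Rightarrow> 'a) \<Rightarrow> ('i \<times> 'a) set rlat" where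
  "rlat_dlim I leq M \<phi> = (let r = dlim_rel I leq M \<phi> in
     lat.extend (lat_dlim I leq M \<phi>)
       (rlat.fields (dlim_op r (\<lambda>i. rmult (M i))) (dlim_op r (\<lambda>i. rimp (M i)))))"


section \<open>Co-annihilators and partitions\<close>

definition coann :: "('a, 'm) lat_scheme \<Rightarrow> 'a set \<Rightarrow> 'a set" where
  "coann M X = {a \<in> carrier M. \<forall>x\<in>X. a \<squnion>\<^bsub>M\<^esub> x = lone M}"

definition CoAnn :: "('a, 'm) lat_scheme \<Rightarrow> 'a set set" where
  "CoAnn M = {coann M X | X. X \<subseteq> carrier M}"

text \<open>The intersection is taken inside the carrier, so that the empty join is \<open>{1}\<close>.\<close>

definition CoAnn_join :: "('a, 'm) lat_scheme \<Rightarrow> 'a set set \<Rightarrow> 'a set" where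
  "CoAnn_join M \<F> = coann M (carrier M \<inter> (\<Inter>F\<in>\<F>. coann M F))"

definition partitions :: "('a, 'm) lat_scheme \<Rightarrow> 'a set set set" where
  "partitions M = {\<C>. finite \<C> \<and> \<C> \<subseteq> CoAnn M - {{lone M}} \<and>
     (\<forall>C\<in>\<C>. \<forall>D\<in>\<C>. C \<noteq> D \<longrightarrow> C \<inter> D = {lone M}) \<and> CoAnn_join M \<C> = carrier M}"

definition refined_by :: "'a set set \<Rightarrow> 'a set set \<Rightarrow> bool" where
  "refined_by \<C> \<D> \<longleftrightarrow> (\<forall>D\<in>\<D>. \<exists>C\<in>\<C>. D \<subseteq> C)"


section \<open>The strongly co-Stone hull\<close>

definition lat_cong :: "('a, 'm) lat_scheme \<Rightarrow> 'a set \<Rightarrow> ('a \<times> 'a) set" where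
  "lat_cong M F = {(a, b). a \<in> carrier M \<and> b \<in> carrier M \<and>
     (\<exists>e\<in>F. a \<sqinter>\<^bsub>M\<^esub> e = b \<sqinter>\<^bsub>M\<^esub> e)}"

definition rlat_cong :: "('a, 'm) rlat_scheme \<Rightarrow> 'a set \<Rightarrow> ('a \<times> 'a) set" where
  "rlat_cong M F = {(a, b). a \<in> carrier M \<and> b \<in> carrier M \<and>
     (a \<leadsto>\<^bsub>M\<^esub> b) \<sqinter>\<^bsub>M\<^esub> (b \<leadsto>\<^bsub>M\<^esub> a) \<in> F}"

text \<open>
  For \<open>D \<subseteq> C\<close>, the image \<open>cong (coann M D) `` (a/C\<^sup>\<top>)\<close> is the class
  \<open>a/D\<^sup>\<top>\<close>, because \<open>C\<^sup>\<top> \<subseteq> D\<^sup>\<top>\<close>; here \<open>cong\<close> is one of the two families of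
  congruences above.
\<close>

definition transition :: "('a, 'm) lat_scheme \<Rightarrow> ('a set \<Rightarrow> ('a \<times> 'a) set) \<Rightarrow>
    'a set set \<Rightarrow> 'a set set \<Rightarrow> ('a set \<Rightarrow> 'a set) \<Rightarrow> ('a set \<Rightarrow> 'a set)" where
  "transition M cong \<C> \<D> f = (\<lambda>D\<in>\<D>. cong (coann M D) `` f (THE C. C \<in> \<C> \<and> D \<subseteq> C))"

definition lat_hull :: "('a, 'm) lat_scheme \<Rightarrow> ('a set set \<times> ('a set \<Rightarrow> 'a set)) set lat" where
  "lat_hull M = lat_dlim (partitions M) refined_by
     (\<lambda>\<C>. lat_prod \<C> (\<lambda>C. lat_quot M (lat_cong M (coann M C))))
     (transition M (lat_cong M))"

definition rlat_hull :: "('a, 'm) rlat_scheme \<Rightarrow> ('a set set \<times> ('a set \<Rightarrow> 'a set)) set rlat" where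
  "rlat_hull M = rlat_dlim (partitions M) refined_by
     (\<lambda>\<C>. rlat_prod \<C> (\<lambda>C. rlat_quot M (rlat_cong M (coann M C))))
     (transition M (rlat_cong M))"

end

theory Submission
  imports Defs
begin

text \<open>
  Since \<open>\<lambda>(a) = 1\<close> only for \<open>a = 1\<close>, the equation \<open>a \<squnion> b = 1\<close> holds in \<open>A\<close> iff
  \<open>\<lambda>(a) \<squnion> \<lambda>(b) = 1\<close> in \<open>\<L>(A)\<close>.  Hence \<open>C \<mapsto> \<lambda>(C)\<close> is an isomorphism between the
  co-annihilators of \<open>A\<close> and those of \<open>\<L>(A)\<close>, and it carries partitions to partitions and
  preserves refinement.  At a partition \<open>\<C>\<close> a family \<open>(a\<^sub>C)\<close> of elements of \<open>A\<close> is sent to the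
  family \<open>(\<lambda>(a\<^sub>C))\<close>.  Modulo a co-annihilator \<open>F\<close>, \<open>a\<^sup>n \<le> b\<close> for some \<open>n \<ge> 1\<close> iff
  \<open>\<lambda>(a) \<le> \<lambda>(b)\<close> modulo \<open>\<lambda>(F)\<close>: from \<open>\<lambda>(a) \<sqinter> \<lambda>(e) \<le> \<lambda>(b)\<close> with \<open>e \<in> F\<close> one gets
  \<open>a\<^sup>n \<odot> e\<^sup>n \<le> b\<close>, and \<open>e\<^sup>n \<in> F\<close>.  As partitions are finite, one exponent serves all their
  members, so the induced map from the hull of \<open>A\<close> onto the hull of \<open>\<L>(A)\<close> identifies the same
  elements as the reticulation map of the hull of \<open>A\<close>.
\<close>

section \<open>Order and co-annihilators in bounded lattices\<close>

context bounded_lattice_alg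
begin

lemma inf_idem: "a \<in> carrier M \<Longrightarrow> a \<sqinter> a = a"
  by (metis inf_closed inf_sup_absorb sup_inf_absorb)

lemma le_refl: "a \<in> carrier M \<Longrightarrow> a \<preceq> a"
  by (simp add: lat_le_def inf_idem)

lemma le_antisym: "\<lbrakk>a \<preceq> b; b \<preceq> a; a \<in> carrier M; b \<in> carrier M\<rbrakk> \<Longrightarrow> a = b"
  unfolding lat_le_def by (metis inf_comm)

lemma le_trans:
  "\<lbrakk>a \<preceq> b; b \<preceq> c; a \<in> carrier M; b \<in> carrier M; c \<in> carrier M\<rbrakk> \<Longrightarrow> a \<preceq> c"
  unfolding lat_le_def by (metis inf_assoc)

lemma inf_le1: "\<lbrakk>a \<in> carrier M; b \<in> carrier M\<rbrakk> \<Longrightarrow> a \<sqinter> b \<preceq> a"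
  unfolding lat_le_def by (metis inf_assoc inf_comm inf_idem)

lemma inf_le2: "\<lbrakk>a \<in> carrier M; b \<in> carrier M\<rbrakk> \<Longrightarrow> a \<sqinter> b \<preceq> b"
  by (metis inf_comm inf_le1)

lemma inf_greatest:
  "\<lbrakk>c \<preceq> a; c \<preceq> b; a \<in> carrier M; b \<in> carrier M; c \<in> carrier M\<rbrakk> \<Longrightarrow> c \<preceq> a \<sqinter> b"
  unfolding lat_le_def by (metis inf_assoc)

lemma le_iff_sup: "\<lbrakk>a \<in> carrier M; b \<in> carrier M\<rbrakk> \<Longrightarrow> a \<preceq> b \<longleftrightarrow> a \<squnion> b = b"
  unfolding lat_le_def by (metis inf_comm inf_sup_absorb sup_comm sup_inf_absorb)

lemma sup_ge1: "\<lbrakk>a \<in> carrier M; b \<in> carrier M\<rbrakk> \<Longrightarrow> a \<preceq> a \<squnion> b"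
  by (simp add: lat_le_def inf_sup_absorb)

lemma sup_ge2: "\<lbrakk>a \<in> carrier M; b \<in> carrier M\<rbrakk> \<Longrightarrow> b \<preceq> a \<squnion> b"
  by (metis sup_comm sup_ge1)

lemma sup_least:
  "\<lbrakk>a \<preceq> c; b \<preceq> c; a \<in> carrier M; b \<in> carrier M; c \<in> carrier M\<rbrakk> \<Longrightarrow> a \<squnion> b \<preceq> c"
  by (metis le_iff_sup sup_assoc sup_closed)

lemma zero_sup: "a \<in> carrier M \<Longrightarrow> lzero M \<squnion> a = a"
  using le_iff_sup zero_closed zero_least by blast

lemma one_sup: "a \<in> carrier M \<Longrightarrow> lone M \<squnion> a = lone M"
  by (metis le_iff_sup one_closed one_greatest sup_comm)

lemma one_leD: "\<lbrakk>lone M \<preceq> a; a \<in> carrier M\<rbrakk> \<Longrightarrow> a = lone M"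
  using le_antisym one_closed one_greatest by blast

section \<open>Co-annihilators as upward closed sets\<close>

lemma coann_subset: "coann M X \<subseteq> carrier M"
  by (auto simp: coann_def)

lemma coann_antimono: "X \<subseteq> Y \<Longrightarrow> coann M Y \<subseteq> coann M X"
  by (auto simp: coann_def)

lemma one_in_coann: "X \<subseteq> carrier M \<Longrightarrow> lone M \<in> coann M X"
  by (auto simp: coann_def one_closed one_sup)

lemma coann_sup:
  "\<lbrakk>X \<subseteq> carrier M; a \<in> coann M X; b \<in> carrier M\<rbrakk> \<Longrightarrow> a \<squnion> b \<in> coann M X"
  unfolding coann_def using one_sup
  by clarsimp (metis subsetD sup_assoc sup_closed sup_comm)

lemma coann_upclosed:
  assumes "X \<subseteq> carrier M" "a \<in> coann M X" "a \<preceq> b" "b \<in> carrier M"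
  shows "b \<in> coann M X"
proof -
  have "a \<in> carrier M" using assms(2) coann_subset by blast
  then have "a \<squnion> b = b" using assms le_iff_sup by blast
  then show ?thesis using coann_sup[OF assms(1,2,4)] by simp
qed

lemma CoAnn_subset: "C \<in> CoAnn M \<Longrightarrow> C \<subseteq> carrier M"
  by (auto simp: CoAnn_def coann_def)

lemma one_in_CoAnn: "C \<in> CoAnn M \<Longrightarrow> lone M \<in> C"
  using one_in_coann by (auto simp: CoAnn_def)

lemma CoAnn_sup: "\<lbrakk>C \<in> CoAnn M; a \<in> C; b \<in> carrier M\<rbrakk> \<Longrightarrow> a \<squnion> b \<in> C"
  using coann_sup by (auto simp: CoAnn_def)

lemma CoAnn_Int: "\<lbrakk>C \<in> CoAnn M; D \<in> CoAnn M\<rbrakk> \<Longrightarrow> C \<inter> D \<in> CoAnn M"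
  unfolding CoAnn_def
proof clarify
  fix X Y assume "X \<subseteq> carrier M" "Y \<subseteq> carrier M"
  then show "\<exists>Z. coann M X \<inter> coann M Y = coann M Z \<and> Z \<subseteq> carrier M"
    by (intro exI[of _ "X \<union> Y"]) (auto simp: coann_def)
qed

text \<open>Since \<open>0 \<squnion> x = x\<close>, the co-annihilator of \<open>X\<close> is everything only for \<open>X \<subseteq> {1}\<close>.\<close>

lemma CoAnn_join_eq_carrier:
  assumes "\<Union>\<C> \<subseteq> carrier M"
  shows "CoAnn_join M \<C> = carrier M \<longleftrightarrow>
    (\<forall>x\<in>carrier M. (\<forall>C\<in>\<C>. \<forall>c\<in>C. x \<squnion> c = lone M) \<longrightarrow> x = lone M)"
    (is "?L \<longleftrightarrow> ?R")
proof
  assume L: ?L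
  show ?R
  proof (intro ballI impI)
    fix x assume x: "x \<in> carrier M" "\<forall>C\<in>\<C>. \<forall>c\<in>C. x \<squnion> c = lone M"
    have "lzero M \<in> CoAnn_join M \<C>" using L zero_closed by simp
    then have "lzero M \<squnion> x = lone M"
      using x unfolding CoAnn_join_def coann_def by blast
    then show "x = lone M" using x zero_sup by simp
  qed
next
  assume R: ?R
  then show ?L unfolding CoAnn_join_def coann_def
    using one_sup one_closed sup_comm by auto
qed

text \<open>The condition that the join is everything becomes elementwise: only 1 joins to 1 with
  all elements of all members. In this form partitions are transported along a reticulation without
  computing joins.\<close>

lemma partitions_iff: "\<C> \<in> partitions M \<longleftrightarrow> finite \<C> \<and> \<C> \<subseteq> CoAnn M - {{lone M}} \<and>
    (\<forall>C\<in>\<C>. \<forall>D\<in>\<C>. C \<noteq> D \<longrightarrow> C \<inter> D = {lone M}) \<and>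
    (\<forall>x\<in>carrier M. (\<forall>C\<in>\<C>. \<forall>c\<in>C. x \<squnion> c = lone M) \<longrightarrow> x = lone M)"
proof -
  have "\<C> \<subseteq> CoAnn M - {{lone M}} \<Longrightarrow> \<Union>\<C> \<subseteq> carrier M"
    using CoAnn_subset by blast
  then show ?thesis unfolding partitions_def using CoAnn_join_eq_carrier by auto
qed

section \<open>Finite partitions: unique parents and common refinements\<close>

lemma partition_memD:
  assumes "\<C> \<in> partitions M" "C \<in> \<C>"
  shows "C \<in> CoAnn M" "C \<subseteq> carrier M" "C \<noteq> {lone M}"
  using assms CoAnn_subset by (auto simp: partitions_iff)

lemma partition_disjoint:
  "\<lbrakk>\<C> \<in> partitions M; C \<in> \<C>; D \<in> \<C>; C \<noteq> D\<rbrakk> \<Longrightarrow> C \<inter> D = {lone M}"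
  unfolding partitions_iff by blast

lemma partition_top:
  "\<lbrakk>\<C> \<in> partitions M; x \<in> carrier M; \<And>C c. \<lbrakk>C \<in> \<C>; c \<in> C\<rbrakk> \<Longrightarrow> x \<squnion> c = lone M\<rbrakk> \<Longrightarrow> x = lone M"
  unfolding partitions_iff by blast

text \<open>Two different members meet in {1}, so \<open>D\<close> would lie inside {1}; but
  \<open>D\<close> contains 1 and differs from {1}.\<close>

lemma partition_parent_unique:
  assumes "\<C> \<in> partitions M" "\<D> \<in> partitions M" "D \<in> \<D>"
    "C \<in> \<C>" "D \<subseteq> C" "C' \<in> \<C>" "D \<subseteq> C'"
  shows "C = C'"
proof (rule ccontr)
  assume "C \<noteq> C'"
  then have "C \<inter> C' = {lone M}" using assms partition_disjoint by blast
  then have "D \<subseteq> {lone M}" using assms by auto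
  then show False
    using assms(2,3) one_in_CoAnn partition_memD by blast
qed

text \<open>The common refinement consists of the intersections \<open>C \<inter> D\<close> other
  than {1}. Its join is everything because \<open>c \<squnion> d\<close> lies in
  \<open>C \<inter> D\<close> for \<open>c\<close> in \<open>C\<close> and \<open>d\<close> in
  \<open>D\<close>: if \<open>x\<close> joins to 1 with all intersections, then
  \<open>x \<squnion> c = 1\<close> because \<open>\<D>\<close> is a partition, and then
  \<open>x = 1\<close> because \<open>\<C>\<close> is one.\<close>

lemma partitions_directed:
  assumes C: "\<C> \<in> partitions M" and D: "\<D> \<in> partitions M"
  obtains \<E> where "\<E> \<in> partitions M" "refined_by \<C> \<E>" "refined_by \<D> \<E>"
proof
  let ?E = "(\<lambda>(C, D). C \<inter> D) ` (\<C> \<times> \<D>) - {{lone M}}"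
  show "refined_by \<C> ?E" "refined_by \<D> ?E" by (auto simp: refined_by_def)
  have fin: "finite ?E" using C D by (auto simp: partitions_iff)
  have sub: "?E \<subseteq> CoAnn M - {{lone M}}"
    using partition_memD(1)[OF C] partition_memD(1)[OF D] CoAnn_Int by auto
  have dis: "X \<inter> Y = {lone M}" if X: "X \<in> ?E" and Y: "Y \<in> ?E" and ne: "X \<noteq> Y" for X Y
  proof -
    obtain C1 D1 C2 D2 where *: "X = C1 \<inter> D1" "Y = C2 \<inter> D2"
      "C1 \<in> \<C>" "C2 \<in> \<C>" "D1 \<in> \<D>" "D2 \<in> \<D>" using X Y by auto
    have "C1 \<noteq> C2 \<or> D1 \<noteq> D2" using ne * by auto
    then have "C1 \<inter> C2 = {lone M} \<or> D1 \<inter> D2 = {lone M}"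
      using * C D partition_disjoint by metis
    then have "X \<inter> Y \<subseteq> {lone M}" using * by auto
    moreover have "lone M \<in> X" "lone M \<in> Y" using X Y sub one_in_CoAnn by auto
    ultimately show ?thesis by auto
  qed
  have top: "x = lone M"
    if x: "x \<in> carrier M" and ann: "\<forall>E\<in>?E. \<forall>e\<in>E. x \<squnion> e = lone M" for x
  proof -
    have all: "x \<squnion> e = lone M" if "C \<in> \<C>" "D \<in> \<D>" "e \<in> C \<inter> D" for e C D
    proof (cases "C \<inter> D = {lone M}")
      \<comment> \<open>Intersections equal to {1} are absent from \<open>?E\<close>, but every
        element joins to 1 with 1.\<close>
      case True
      then show ?thesis using that x one_sup one_closed sup_comm by auto
    next
      case False
      then have "C \<inter> D \<in> ?E" using that by auto
      then have "\<forall>e\<in>C \<inter> D. x \<squnion> e = lone M" by (rule bspec[OF ann])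
      then show ?thesis using that(3) by (rule bspec)
    qed
    have "x \<squnion> c = lone M" if c: "C \<in> \<C>" "c \<in> C" for C c
    proof -
      have cc: "c \<in> carrier M" using c partition_memD(2)[OF C] by blast
      have "(x \<squnion> c) \<squnion> d = lone M" if d: "D0 \<in> \<D>" "d \<in> D0" for D0 d
      proof -
        have dc: "d \<in> carrier M" using d partition_memD(2)[OF D] by blast
        have "c \<squnion> d \<in> C" using c dc CoAnn_sup partition_memD(1)[OF C] by blast
        moreover have "c \<squnion> d \<in> D0"
          using d cc dc CoAnn_sup[of D0 d c] partition_memD(1)[OF D] sup_comm by metis
        ultimately show ?thesis using all c d x cc dc by (simp add: sup_assoc)
      qed
      then show ?thesis using partition_top[OF D] x cc sup_closed by blast
    qed
    then show ?thesis using partition_top[OF C x] by blast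
  qed
  show "?E \<in> partitions M"
    unfolding partitions_iff by (intro conjI fin sub ballI impI) (rule dis top; assumption)+
qed

end

lemma refined_by_refl: "refined_by \<C> \<C>"
  by (auto simp: refined_by_def)

lemma refined_by_trans: "\<lbrakk>refined_by \<C> \<D>; refined_by \<D> \<E>\<rbrakk> \<Longrightarrow> refined_by \<C> \<E>"
  unfolding refined_by_def by (meson subset_trans)


section \<open>Families over partitions as elements of the hull\<close>

text \<open>Common frame for both hulls: \<open>\<theta>\<close> will be \<open>lat_cong\<close> or
  \<open>rlat_cong\<close>. The points of the direct limit depend only on these congruences, so they
  are analysed once; the operations enter later through their compatibility with
  \<open>\<theta>\<close>.\<close>

locale hull_system = bounded_lattice_alg M for M :: "('a, 'm) lat_scheme" (structure) +
  fixes \<theta> :: "'a set \<Rightarrow> ('a \<times> 'a) set"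
  assumes equiv_cong: "X \<subseteq> carrier M \<Longrightarrow> equiv (carrier M) (\<theta> (coann M X))"
    and cong_mono: "F \<subseteq> G \<Longrightarrow> \<theta> F \<subseteq> \<theta> G"
begin

abbreviation q :: "'a set \<Rightarrow> ('a \<times> 'a) set" where
  "q C \<equiv> \<theta> (coann M C)"

text \<open>The index map behind \<open>transition\<close>: the component at \<open>D\<close> of a
  transported family is read off at \<open>par \<C> D\<close>.\<close>

definition par :: "'a set set \<Rightarrow> 'a set \<Rightarrow> 'a set" where
  "par \<C> D = (THE C. C \<in> \<C> \<and> D \<subseteq> C)"

text \<open>Elements of a stage are handled through families of representatives in \<open>M\<close>,
  which keeps quotient classes out of the later arguments.\<close>

definition cls :: "'a set set \<Rightarrow> ('a set \<Rightarrow> 'a) \<Rightarrow> 'a set \<Rightarrow> 'a set" where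
  "cls \<C> a = (\<lambda>C\<in>\<C>. q C `` {a C})"

text \<open>Eventual equality sees only carriers and transition maps, so this relation, stated with
  the plain lattice products, also serves the residuated hull
  (\<open>rlat_hull_rel\<close>).\<close>

definition rel :: "(('a set set \<times> ('a set \<Rightarrow> 'a set)) \<times> ('a set set \<times> ('a set \<Rightarrow> 'a set))) set" where
  "rel = dlim_rel (partitions M) refined_by (\<lambda>\<C>. lat_prod \<C> (\<lambda>C. lat_quot M (q C)))
     (transition M \<theta>)"

definition el :: "'a set set \<Rightarrow> ('a set \<Rightarrow> 'a) \<Rightarrow> ('a set set \<times> ('a set \<Rightarrow> 'a set)) set" where
  "el \<C> a = rel `` {(\<C>, cls \<C> a)}"

text \<open>Equality of the two families after transport to the stage \<open>\<E>\<close>, expressed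
  by representatives.\<close>

definition agree :: "'a set set \<Rightarrow> ('a set \<Rightarrow> 'a) \<Rightarrow> 'a set set \<Rightarrow> ('a set \<Rightarrow> 'a) \<Rightarrow> 'a set set \<Rightarrow> bool" where
  "agree \<C> a \<D> b \<E> \<longleftrightarrow> refined_by \<C> \<E> \<and> refined_by \<D> \<E> \<and>
     (\<forall>E\<in>\<E>. (a (par \<C> E), b (par \<D> E)) \<in> q E)"

lemma par_eq:
  assumes "\<C> \<in> partitions M" "\<D> \<in> partitions M" "D \<in> \<D>" "C \<in> \<C>" "D \<subseteq> C"
  shows "par \<C> D = C"
  unfolding par_def using partition_parent_unique[OF assms(1-3)] assms(4,5)
  by (intro the_equality) auto

lemma par_mem:
  assumes "\<C> \<in> partitions M" "\<D> \<in> partitions M" "refined_by \<C> \<D>" "D \<in> \<D>"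
  shows "par \<C> D \<in> \<C>" "D \<subseteq> par \<C> D"
proof -
  obtain C where "C \<in> \<C>" "D \<subseteq> C" using assms by (auto simp: refined_by_def)
  then show "par \<C> D \<in> \<C>" "D \<subseteq> par \<C> D" using par_eq[OF assms(1,2,4)] by auto
qed

lemma par_self: "\<lbrakk>\<C> \<in> partitions M; C \<in> \<C>\<rbrakk> \<Longrightarrow> par \<C> C = C"
  using par_eq by blast

text \<open>Functoriality of the transition maps on indices: \<open>E\<close> lies in
  \<open>par \<D> E\<close>, which lies in \<open>par \<C> (par \<D> E)\<close>, and parents are
  unique.\<close>

lemma par_par:
  assumes "\<C> \<in> partitions M" "\<D> \<in> partitions M" "\<E> \<in> partitions M"
    "refined_by \<C> \<D>" "refined_by \<D> \<E>" "E \<in> \<E>"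
  shows "par \<C> (par \<D> E) = par \<C> E"
proof -
  have D: "par \<D> E \<in> \<D>" "E \<subseteq> par \<D> E" using par_mem assms by auto
  then have "par \<C> (par \<D> E) \<in> \<C>" "par \<D> E \<subseteq> par \<C> (par \<D> E)"
    using par_mem assms by auto
  then show ?thesis using par_eq[of \<C> \<E> E] D assms by auto
qed

text \<open>A smaller index has a larger co-annihilator and hence a coarser congruence; this is why
  classes can be pushed forward along refinements.\<close>

lemma q_mono: "D \<subseteq> C \<Longrightarrow> q C \<subseteq> q D"
  by (intro cong_mono coann_antimono)

lemma q_equiv: "\<lbrakk>\<C> \<in> partitions M; C \<in> \<C>\<rbrakk> \<Longrightarrow> equiv (carrier M) (q C)"
  using equiv_cong partition_memD(2) by blast

lemma q_refl: "\<lbrakk>\<C> \<in> partitions M; C \<in> \<C>; x \<in> carrier M\<rbrakk> \<Longrightarrow> (x, x) \<in> q C"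
  using q_equiv by (meson equivE refl_onD)

lemma q_trans: "\<lbrakk>\<C> \<in> partitions M; C \<in> \<C>; (x, y) \<in> q C; (y, z) \<in> q C\<rbrakk> \<Longrightarrow> (x, z) \<in> q C"
  using q_equiv by (meson equivE transD)

lemma cls_in_stage:
  assumes "\<C> \<in> partitions M" "a \<in> \<C> \<rightarrow> carrier M"
  shows "cls \<C> a \<in> (\<Pi>\<^sub>E C\<in>\<C>. carrier M // q C)"
  using assms unfolding cls_def by (auto intro!: quotientI)

lemma stage_cls:
  assumes "\<C> \<in> partitions M" "f \<in> (\<Pi>\<^sub>E C\<in>\<C>. carrier M // q C)"
  obtains a where "a \<in> \<C> \<rightarrow> carrier M" "f = cls \<C> a"
proof -
  have "\<forall>C\<in>\<C>. \<exists>x\<in>carrier M. f C = q C `` {x}"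
    using assms(2) by (auto simp: PiE_iff elim!: quotientE)
  then obtain a where a: "\<forall>C\<in>\<C>. a C \<in> carrier M \<and> f C = q C `` {a C}" by metis
  show thesis
  proof
    show "a \<in> \<C> \<rightarrow> carrier M" using a by auto
    show "f = cls \<C> a" using a assms(2) by (auto simp: cls_def fun_eq_iff PiE_iff extensional_def)
  qed
qed

lemma transition_cls:
  assumes "\<C> \<in> partitions M" "\<E> \<in> partitions M" "refined_by \<C> \<E>" "a \<in> \<C> \<rightarrow> carrier M"
  shows "transition M \<theta> \<C> \<E> (cls \<C> a) = cls \<E> (\<lambda>E. a (par \<C> E))"
proof
  fix E
  show "transition M \<theta> \<C> \<E> (cls \<C> a) E = cls \<E> (\<lambda>E. a (par \<C> E)) E"
  proof (cases "E \<in> \<E>")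
    case True
    then have C: "par \<C> E \<in> \<C>" "E \<subseteq> par \<C> E" using par_mem assms by auto
    then have x: "a (par \<C> E) \<in> carrier M" using assms(4) by auto
    \<comment> \<open>The congruence at the parent is contained in \<open>q E\<close>, so saturating
      a parent class by \<open>q E\<close> yields a single class of \<open>q E\<close>.\<close>
    have "q E `` (q (par \<C> E) `` {a (par \<C> E)}) = q E `` {a (par \<C> E)}"
      using q_mono[OF C(2)] q_trans[OF assms(2) True] q_refl[OF assms(1) C(1) x] by blast
    then show ?thesis using True C by (simp add: transition_def cls_def par_def[symmetric])
  qed (simp add: transition_def cls_def)
qed

lemma cls_eq_iff:
  assumes "\<E> \<in> partitions M" "a \<in> \<E> \<rightarrow> carrier M" "b \<in> \<E> \<rightarrow> carrier M"
  shows "cls \<E> a = cls \<E> b \<longleftrightarrow> (\<forall>E\<in>\<E>. (a E, b E) \<in> q E)"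
proof -
  have "(q E `` {a E} = q E `` {b E}) \<longleftrightarrow> (a E, b E) \<in> q E" if "E \<in> \<E>" for E
    using eq_equiv_class_iff[OF q_equiv[OF assms(1) that]] assms that by auto
  then show ?thesis unfolding cls_def by (auto simp: fun_eq_iff restrict_def)
qed

lemma rel_cls_iff:
  assumes "\<C> \<in> partitions M" "a \<in> \<C> \<rightarrow> carrier M" "\<D> \<in> partitions M" "b \<in> \<D> \<rightarrow> carrier M"
  shows "((\<C>, cls \<C> a), (\<D>, cls \<D> b)) \<in> rel \<longleftrightarrow> (\<exists>\<E>\<in>partitions M. agree \<C> a \<D> b \<E>)"
proof -
  have "(transition M \<theta> \<C> \<E> (cls \<C> a) = transition M \<theta> \<D> \<E> (cls \<D> b)) \<longleftrightarrow>
      (\<forall>E\<in>\<E>. (a (par \<C> E), b (par \<D> E)) \<in> q E)"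
    if "\<E> \<in> partitions M" "refined_by \<C> \<E>" "refined_by \<D> \<E>" for \<E>
  proof -
    have "(\<lambda>E. a (par \<C> E)) \<in> \<E> \<rightarrow> carrier M" "(\<lambda>E. b (par \<D> E)) \<in> \<E> \<rightarrow> carrier M"
      using par_mem assms that by (auto simp: Pi_iff)
    then show ?thesis using that assms by (simp add: transition_cls cls_eq_iff)
  qed
  then show ?thesis
    using assms cls_in_stage[OF assms(1,2)] cls_in_stage[OF assms(3,4)]
    unfolding rel_def dlim_rel_def agree_def by (auto simp: lat_prod_def lat_quot_def)
qed

text \<open>Agreement persists because the congruence at \<open>par \<E> F\<close> is contained in
  the one at \<open>F\<close>.\<close>

lemma agree_refine:
  assumes "agree \<C> a \<D> b \<E>" "refined_by \<E> \<F>" "\<C> \<in> partitions M" "\<D> \<in> partitions M"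
    "\<E> \<in> partitions M" "\<F> \<in> partitions M"
  shows "agree \<C> a \<D> b \<F>"
  unfolding agree_def
proof (intro conjI ballI)
  show "refined_by \<C> \<F>" "refined_by \<D> \<F>"
    using assms refined_by_trans unfolding agree_def by blast+
  fix F assume F: "F \<in> \<F>"
  then have E: "par \<E> F \<in> \<E>" "F \<subseteq> par \<E> F" using par_mem assms by auto
  then have "(a (par \<C> (par \<E> F)), b (par \<D> (par \<E> F))) \<in> q F"
    using assms(1) q_mono unfolding agree_def by blast
  then show "(a (par \<C> F), b (par \<D> F)) \<in> q F"
    using par_par F assms unfolding agree_def by metis
qed

lemma rel_carrier:
  "rel \<subseteq> (SIGMA \<C>:partitions M. \<Pi>\<^sub>E C\<in>\<C>. carrier M // q C) \<times>
    (SIGMA \<C>:partitions M. \<Pi>\<^sub>E C\<in>\<C>. carrier M // q C)"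
  unfolding rel_def dlim_rel_def by (auto simp: lat_prod_def lat_quot_def)

text \<open>Transitivity is where directedness enters: the two agreements are moved to a common
  refinement and composed there.\<close>

lemma equiv_rel: "equiv (SIGMA \<C>:partitions M. \<Pi>\<^sub>E C\<in>\<C>. carrier M // q C) rel"
proof (rule equivI)
  show "rel \<subseteq> (SIGMA \<C>:partitions M. \<Pi>\<^sub>E C\<in>\<C>. carrier M // q C) \<times>
    (SIGMA \<C>:partitions M. \<Pi>\<^sub>E C\<in>\<C>. carrier M // q C)" by (rule rel_carrier)
  show "refl_on (SIGMA \<C>:partitions M. \<Pi>\<^sub>E C\<in>\<C>. carrier M // q C) rel"
  proof (rule refl_onI)
    fix x assume "x \<in> (SIGMA \<C>:partitions M. \<Pi>\<^sub>E C\<in>\<C>. carrier M // q C)"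
    then obtain \<C> f where x: "x = (\<C>, f)" "\<C> \<in> partitions M"
      "f \<in> (\<Pi>\<^sub>E C\<in>\<C>. carrier M // q C)" by blast
    then show "(x, x) \<in> rel"
      using refined_by_refl unfolding rel_def dlim_rel_def by (auto simp: lat_prod_def lat_quot_def)
  qed
  show "sym rel" unfolding rel_def dlim_rel_def by (rule symI) (auto; metis)
  show "trans rel"
  proof (rule transI)
    fix x y z assume xy: "(x, y) \<in> rel" and yz: "(y, z) \<in> rel"
    obtain \<C> f \<D> g \<B> h where
      x: "x = (\<C>, f)" "\<C> \<in> partitions M" "f \<in> (\<Pi>\<^sub>E C\<in>\<C>. carrier M // q C)" and
      y: "y = (\<D>, g)" "\<D> \<in> partitions M" "g \<in> (\<Pi>\<^sub>E C\<in>\<D>. carrier M // q C)" and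
      z: "z = (\<B>, h)" "\<B> \<in> partitions M" "h \<in> (\<Pi>\<^sub>E C\<in>\<B>. carrier M // q C)"
      using xy yz rel_carrier by (cases x; cases y; cases z) blast
    obtain a where a: "a \<in> \<C> \<rightarrow> carrier M" "f = cls \<C> a" using stage_cls x by blast
    obtain b where b: "b \<in> \<D> \<rightarrow> carrier M" "g = cls \<D> b" using stage_cls y by blast
    obtain c where c: "c \<in> \<B> \<rightarrow> carrier M" "h = cls \<B> c" using stage_cls z by blast
    obtain \<E> where E: "\<E> \<in> partitions M" "agree \<C> a \<D> b \<E>"
      using xy rel_cls_iff x y a b by auto
    obtain \<F> where F: "\<F> \<in> partitions M" "agree \<D> b \<B> c \<F>"
      using yz rel_cls_iff y z b c by auto
    obtain \<G> where G: "\<G> \<in> partitions M" "refined_by \<E> \<G>" "refined_by \<F> \<G>"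
      using partitions_directed E F by blast
    have "agree \<C> a \<D> b \<G>" "agree \<D> b \<B> c \<G>"
      using agree_refine E F G x y z by blast+
    then have "agree \<C> a \<B> c \<G>"
      using q_trans[OF G(1)] unfolding agree_def by blast
    then show "(x, z) \<in> rel" using G rel_cls_iff x z a c by auto
  qed
qed

lemma el_eq_iff:
  assumes "\<C> \<in> partitions M" "a \<in> \<C> \<rightarrow> carrier M" "\<D> \<in> partitions M" "b \<in> \<D> \<rightarrow> carrier M"
  shows "el \<C> a = el \<D> b \<longleftrightarrow> (\<exists>\<E>\<in>partitions M. agree \<C> a \<D> b \<E>)"
  unfolding el_def rel_cls_iff[OF assms, symmetric]
  using eq_equiv_class_iff[OF equiv_rel] cls_in_stage assms by auto

lemma el_eq_iff_stage:
  assumes "\<C> \<in> partitions M" "a \<in> \<C> \<rightarrow> carrier M" "b \<in> \<C> \<rightarrow> carrier M"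
  shows "el \<C> a = el \<C> b \<longleftrightarrow>
    (\<exists>\<E>\<in>partitions M. refined_by \<C> \<E> \<and> (\<forall>E\<in>\<E>. (a (par \<C> E), b (par \<C> E)) \<in> q E))"
  using el_eq_iff[OF assms(1,2,1,3)] by (auto simp: agree_def)

lemma el_cong: "(\<And>C. C \<in> \<C> \<Longrightarrow> a C = b C) \<Longrightarrow> el \<C> a = el \<C> b"
  unfolding el_def cls_def by (metis (mono_tags, lifting) restrict_ext)

lemma el_refine:
  assumes "\<C> \<in> partitions M" "a \<in> \<C> \<rightarrow> carrier M" "\<E> \<in> partitions M" "refined_by \<C> \<E>"
  shows "el \<C> a = el \<E> (\<lambda>E. a (par \<C> E))"
proof -
  have m: "(\<lambda>E. a (par \<C> E)) \<in> \<E> \<rightarrow> carrier M" using par_mem assms by (auto simp: Pi_iff)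
  \<comment> \<open>The stage \<open>\<E>\<close> itself witnesses the equality, since each of its
    members is its own parent there.\<close>
  then have "agree \<C> a \<E> (\<lambda>E. a (par \<C> E)) \<E>"
    using assms refined_by_refl q_refl[OF assms(3)] by (auto simp: agree_def par_self Pi_iff)
  then show ?thesis using el_eq_iff m assms by blast
qed

lemma quotient_rel_eq:
  "(SIGMA \<C>:partitions M. \<Pi>\<^sub>E C\<in>\<C>. carrier M // q C) // rel =
    {el \<C> a | \<C> a. \<C> \<in> partitions M \<and> a \<in> \<C> \<rightarrow> carrier M}"
proof (intro equalityI subsetI)
  fix X assume "X \<in> (SIGMA \<C>:partitions M. \<Pi>\<^sub>E C\<in>\<C>. carrier M // q C) // rel"
  then obtain \<C> f where "\<C> \<in> partitions M" "f \<in> (\<Pi>\<^sub>E C\<in>\<C>. carrier M // q C)"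
    "X = rel `` {(\<C>, f)}" by (auto elim!: quotientE)
  then show "X \<in> {el \<C> a | \<C> a. \<C> \<in> partitions M \<and> a \<in> \<C> \<rightarrow> carrier M}"
    using stage_cls unfolding el_def by blast
next
  fix X assume "X \<in> {el \<C> a | \<C> a. \<C> \<in> partitions M \<and> a \<in> \<C> \<rightarrow> carrier M}"
  then obtain \<C> a where C: "\<C> \<in> partitions M" "a \<in> \<C> \<rightarrow> carrier M" "X = el \<C> a" by auto
  show "X \<in> (SIGMA \<C>:partitions M. \<Pi>\<^sub>E C\<in>\<C>. carrier M // q C) // rel"
    unfolding C(3) el_def by (intro quotientI SigmaI cls_in_stage C)
qed

section \<open>Operations and constants of the direct limit\<close>

lemma el_memE:
  assumes "(\<D>, g) \<in> el \<C> a" "\<C> \<in> partitions M" "a \<in> \<C> \<rightarrow> carrier M"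
  obtains b where "\<D> \<in> partitions M" "b \<in> \<D> \<rightarrow> carrier M" "g = cls \<D> b" "el \<D> b = el \<C> a"
proof -
  have r: "((\<C>, cls \<C> a), (\<D>, g)) \<in> rel" using assms by (auto simp: el_def)
  then have D: "\<D> \<in> partitions M" "g \<in> (\<Pi>\<^sub>E C\<in>\<D>. carrier M // q C)" using rel_carrier by auto
  then obtain b where b: "b \<in> \<D> \<rightarrow> carrier M" "g = cls \<D> b" using stage_cls by blast
  have "el \<D> b = el \<C> a"
    unfolding el_def using r b equiv_class_eq[OF equiv_rel] by blast
  then show thesis using that D b by blast
qed

lemma el_self: "\<lbrakk>\<C> \<in> partitions M; a \<in> \<C> \<rightarrow> carrier M\<rbrakk> \<Longrightarrow> (\<C>, cls \<C> a) \<in> el \<C> a"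
  unfolding el_def using equiv_class_self[OF equiv_rel] cls_in_stage by auto

text \<open>\<open>quot_op\<close> is a union over all representatives of both classes;
  compatibility makes every set in that union the class of \<open>f (a C) (b C)\<close>.\<close>

lemma prod_op_cls:
  assumes f: "\<And>x y. \<lbrakk>x \<in> carrier M; y \<in> carrier M\<rbrakk> \<Longrightarrow> f x y \<in> carrier M"
    and cong: "\<And>X x y x' y'. \<lbrakk>X \<subseteq> carrier M; (x, x') \<in> q X; (y, y') \<in> q X\<rbrakk>
      \<Longrightarrow> (f x y, f x' y') \<in> q X"
    and "\<C> \<in> partitions M" "a \<in> \<C> \<rightarrow> carrier M" "b \<in> \<C> \<rightarrow> carrier M"
  shows "prod_op \<C> (\<lambda>C. quot_op (q C) f) (cls \<C> a) (cls \<C> b) = cls \<C> (\<lambda>C. f (a C) (b C))"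
proof -
  have "quot_op (q C) f (q C `` {a C}) (q C `` {b C}) = q C `` {f (a C) (b C)}" if C: "C \<in> \<C>" for C
  proof -
    have sub: "C \<subseteq> carrier M" using C assms(3) partition_memD(2) by blast
    have e: "equiv (carrier M) (q C)" using q_equiv C assms(3) by blast
    have "q C `` {f x y} = q C `` {f (a C) (b C)}" if "(a C, x) \<in> q C" "(b C, y) \<in> q C" for x y
      using equiv_class_eq[OF e cong[OF sub that]] by simp
    moreover have "(a C, a C) \<in> q C" "(b C, b C) \<in> q C"
      using q_refl C assms by blast+
    ultimately show ?thesis unfolding quot_op_def by blast
  qed
  then show ?thesis unfolding prod_op_def cls_def by (auto simp: fun_eq_iff restrict_def)
qed

text \<open>\<open>dlim_op\<close> is a union over all pairs of representatives at a common stage.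
  Any such pair agrees with the given families on a common refinement, where compatibility of
  \<open>f\<close> applies, so all sets in the union coincide.\<close>

lemma dlim_op_el:
  assumes f: "\<And>x y. \<lbrakk>x \<in> carrier M; y \<in> carrier M\<rbrakk> \<Longrightarrow> f x y \<in> carrier M"
    and cong: "\<And>X x y x' y'. \<lbrakk>X \<subseteq> carrier M; (x, x') \<in> q X; (y, y') \<in> q X\<rbrakk>
      \<Longrightarrow> (f x y, f x' y') \<in> q X"
    and C: "\<C> \<in> partitions M" and a: "a \<in> \<C> \<rightarrow> carrier M" and b: "b \<in> \<C> \<rightarrow> carrier M"
  shows "dlim_op rel (\<lambda>\<C>. prod_op \<C> (\<lambda>C. quot_op (q C) f)) (el \<C> a) (el \<C> b) =
    el \<C> (\<lambda>C. f (a C) (b C))"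
proof -
  let ?f = "\<lambda>\<C>. prod_op \<C> (\<lambda>C. quot_op (q C) f)"
  have ab: "(\<lambda>C. f (a C) (b C)) \<in> \<C> \<rightarrow> carrier M" using a b f by (auto simp: Pi_iff)
  have same: "rel `` {(\<D>, ?f \<D> x y)} = el \<C> (\<lambda>C. f (a C) (b C))"
    if "(\<D>, x) \<in> el \<C> a" "(\<D>, y) \<in> el \<C> b" for \<D> x y
  proof -
    obtain a' where a': "\<D> \<in> partitions M" "a' \<in> \<D> \<rightarrow> carrier M" "x = cls \<D> a'" "el \<D> a' = el \<C> a"
      by (rule el_memE[OF \<open>(\<D>, x) \<in> el \<C> a\<close> C a])
    obtain b' where b': "b' \<in> \<D> \<rightarrow> carrier M" "y = cls \<D> b'" "el \<D> b' = el \<C> b"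
      by (rule el_memE[OF \<open>(\<D>, y) \<in> el \<C> b\<close> C b])
    have ab': "(\<lambda>C. f (a' C) (b' C)) \<in> \<D> \<rightarrow> carrier M" using a' b' f by (auto simp: Pi_iff)
    obtain \<E> where E: "\<E> \<in> partitions M" "agree \<D> a' \<C> a \<E>" using a' a C el_eq_iff by blast
    obtain \<F> where F: "\<F> \<in> partitions M" "agree \<D> b' \<C> b \<F>" using a' b' b C el_eq_iff by blast
    obtain \<G> where G: "\<G> \<in> partitions M" "refined_by \<E> \<G>" "refined_by \<F> \<G>"
      using partitions_directed E F by blast
    have "agree \<D> a' \<C> a \<G>" "agree \<D> b' \<C> b \<G>" using agree_refine E F G a' C by blast+
    then have "agree \<D> (\<lambda>C. f (a' C) (b' C)) \<C> (\<lambda>C. f (a C) (b C)) \<G>"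
      unfolding agree_def using cong partition_memD(2)[OF G(1)] by blast
    then have "el \<D> (\<lambda>C. f (a' C) (b' C)) = el \<C> (\<lambda>C. f (a C) (b C))"
      using el_eq_iff ab ab' a' C G by blast
    moreover have "?f \<D> x y = cls \<D> (\<lambda>C. f (a' C) (b' C))"
      using prod_op_cls[of f \<D> a' b'] f cong a' b' by blast
    ultimately show ?thesis by (simp add: el_def)
  qed
  have "{rel `` {(k, ?f k x y)} | k x y. (k, x) \<in> el \<C> a \<and> (k, y) \<in> el \<C> b} =
      {el \<C> (\<lambda>C. f (a C) (b C))}"
    using same el_self[OF C a] el_self[OF C b] by blast
  then show ?thesis unfolding dlim_op_def by simp
qed

text \<open>Constant families over two partitions coincide at a common refinement. This computes 0
  and 1 of the hull at an arbitrary stage.\<close>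

lemma dlim_const_el:
  assumes "\<C> \<in> partitions M" "x \<in> carrier M"
  shows "(\<Union>\<D>\<in>partitions M. rel `` {(\<D>, \<lambda>C\<in>\<D>. q C `` {x})}) = el \<C> (\<lambda>_. x)"
proof -
  have "el \<D> (\<lambda>_. x) = el \<C> (\<lambda>_. x)" if D: "\<D> \<in> partitions M" for \<D>
  proof -
    obtain \<E> where E: "\<E> \<in> partitions M" "refined_by \<C> \<E>" "refined_by \<D> \<E>"
      using partitions_directed assms D by blast
    have "el \<D> (\<lambda>_. x) = el \<E> (\<lambda>_. x)" "el \<C> (\<lambda>_. x) = el \<E> (\<lambda>_. x)"
      using el_refine[of _ "\<lambda>_. x" \<E>] E D assms by auto
    then show ?thesis by simp
  qed
  then have "(\<Union>\<D>\<in>partitions M. el \<D> (\<lambda>_. x)) = el \<C> (\<lambda>_. x)"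
    using assms(1) by blast
  then show ?thesis unfolding el_def cls_def .
qed

text \<open>Allows two elements of the hull to be treated as families over a single partition, as
  binary operations require.\<close>

lemma el_common_stage:
  assumes "\<C> \<in> partitions M" "a \<in> \<C> \<rightarrow> carrier M" "\<D> \<in> partitions M" "b \<in> \<D> \<rightarrow> carrier M"
  obtains \<E> where "\<E> \<in> partitions M" "refined_by \<C> \<E>" "refined_by \<D> \<E>"
    "(\<lambda>E. a (par \<C> E)) \<in> \<E> \<rightarrow> carrier M" "(\<lambda>E. b (par \<D> E)) \<in> \<E> \<rightarrow> carrier M"
    "el \<C> a = el \<E> (\<lambda>E. a (par \<C> E))" "el \<D> b = el \<E> (\<lambda>E. b (par \<D> E))"
proof -
  obtain \<E> where E: "\<E> \<in> partitions M" "refined_by \<C> \<E>" "refined_by \<D> \<E>"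
    using partitions_directed assms by blast
  have "(\<lambda>E. a (par \<C> E)) \<in> \<E> \<rightarrow> carrier M" "(\<lambda>E. b (par \<D> E)) \<in> \<E> \<rightarrow> carrier M"
    using par_mem assms E by (auto simp: Pi_iff)
  then show thesis using that E el_refine assms by blast
qed

end


section \<open>The hull of a bounded distributive lattice\<close>

context bounded_distrib_lattice_alg
begin

text \<open>Distributivity gives \<open>a = a \<sqinter> (b \<squnion> x) = (a \<sqinter> b)
  \<squnion> (a \<sqinter> x)\<close>, which is below \<open>(a \<sqinter> b) \<squnion> x\<close>;
  hence so is \<open>a \<squnion> x = 1\<close>.\<close>

lemma coann_inf:
  assumes "X \<subseteq> carrier M" "a \<in> coann M X" "b \<in> coann M X"
  shows "a \<sqinter> b \<in> coann M X"
proof -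
  have c: "a \<in> carrier M" "b \<in> carrier M" using assms coann_subset by auto
  have "(a \<sqinter> b) \<squnion> x = lone M" if x: "x \<in> X" for x
  proof -
    have xc: "x \<in> carrier M" and ax: "a \<squnion> x = lone M" and bx: "b \<squnion> x = lone M"
      using x assms unfolding coann_def by blast+
    have "a = a \<sqinter> (b \<squnion> x)" using c bx one_greatest by (simp add: lat_le_def)
    also have "\<dots> = (a \<sqinter> b) \<squnion> (a \<sqinter> x)" using c xc by (rule inf_sup_distrib)
    finally have "(a \<sqinter> b) \<squnion> (a \<sqinter> x) = a" ..
    moreover have "(a \<sqinter> b) \<squnion> (a \<sqinter> x) \<preceq> (a \<sqinter> b) \<squnion> x"
    proof (rule sup_least)
      show "a \<sqinter> x \<preceq> (a \<sqinter> b) \<squnion> x"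
        using le_trans[OF inf_le2 sup_ge2] c xc inf_closed sup_closed by simp
    qed (use c xc inf_closed sup_closed sup_ge1 in simp_all)
    ultimately have "a \<preceq> (a \<sqinter> b) \<squnion> x" by simp
    then have "a \<squnion> x \<preceq> (a \<sqinter> b) \<squnion> x"
      using c xc inf_closed sup_closed sup_ge2 sup_least by simp
    then show ?thesis using ax c xc one_leD inf_closed sup_closed by simp
  qed
  then show ?thesis using c inf_closed by (simp add: coann_def)
qed

text \<open>Splits the equality of truncations into two inequalities, the form that a reticulation
  can translate into products and powers.\<close>

lemma lat_cong_iff:
  assumes "F \<subseteq> carrier M"
  shows "(x, y) \<in> lat_cong M F \<longleftrightarrow>
    x \<in> carrier M \<and> y \<in> carrier M \<and> (\<exists>e\<in>F. x \<sqinter> e \<preceq> y \<and> y \<sqinter> e \<preceq> x)"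
proof -
  have "x \<sqinter> e = y \<sqinter> e \<longleftrightarrow> x \<sqinter> e \<preceq> y \<and> y \<sqinter> e \<preceq> x"
    if "x \<in> carrier M" "y \<in> carrier M" "e \<in> F" for e
  proof
    have e: "e \<in> carrier M" using that assms by blast
    show "x \<sqinter> e \<preceq> y \<and> y \<sqinter> e \<preceq> x" if "x \<sqinter> e = y \<sqinter> e"
      using that e inf_le1 \<open>x \<in> carrier M\<close> \<open>y \<in> carrier M\<close> by metis
    show "x \<sqinter> e = y \<sqinter> e" if "x \<sqinter> e \<preceq> y \<and> y \<sqinter> e \<preceq> x"
      using that e \<open>x \<in> carrier M\<close> \<open>y \<in> carrier M\<close>
      by (meson inf_closed inf_greatest inf_le2 le_antisym)
  qed
  then show ?thesis unfolding lat_cong_def by blast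
qed

lemma inf_le_weaken:
  "\<lbrakk>x \<sqinter> e \<preceq> y; d \<preceq> e; x \<in> carrier M; y \<in> carrier M; d \<in> carrier M; e \<in> carrier M\<rbrakk>
    \<Longrightarrow> x \<sqinter> d \<preceq> y"
  by (meson inf_closed inf_greatest inf_le1 inf_le2 le_trans)

text \<open>Each inequality may have its own witness because \<open>e \<sqinter> d\<close> serves
  for both. The two halves of the congruence can thus be compared with the residuated side
  separately.\<close>

lemma lat_cong_coann_iff2:
  assumes "X \<subseteq> carrier M"
  shows "(x, y) \<in> lat_cong M (coann M X) \<longleftrightarrow> x \<in> carrier M \<and> y \<in> carrier M \<and>
    (\<exists>e\<in>coann M X. x \<sqinter> e \<preceq> y) \<and> (\<exists>e\<in>coann M X. y \<sqinter> e \<preceq> x)" (is "?L \<longleftrightarrow> ?R")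
proof
  assume ?L then show ?R using lat_cong_iff[OF coann_subset] by blast
next
  assume ?R
  then obtain e d where *: "x \<in> carrier M" "y \<in> carrier M"
    "e \<in> coann M X" "x \<sqinter> e \<preceq> y" "d \<in> coann M X" "y \<sqinter> d \<preceq> x" by blast
  then have ed: "e \<in> carrier M" "d \<in> carrier M" using coann_subset by auto
  have "x \<sqinter> (e \<sqinter> d) \<preceq> y" "y \<sqinter> (e \<sqinter> d) \<preceq> x"
    using * ed inf_le_weaken inf_le1 inf_le2 inf_closed by metis+
  then show ?L
    using * coann_inf[OF assms] lat_cong_iff[OF coann_subset] by blast
qed

lemma equiv_lat_cong:
  assumes X: "X \<subseteq> carrier M"
  shows "equiv (carrier M) (lat_cong M (coann M X))"
proof (rule equivI)
  show "lat_cong M (coann M X) \<subseteq> carrier M \<times> carrier M" by (auto simp: lat_cong_def)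
  show "refl_on (carrier M) (lat_cong M (coann M X))"
    using one_in_coann[OF X] by (auto simp: refl_on_def lat_cong_def)
  show "sym (lat_cong M (coann M X))"
    unfolding lat_cong_def by (rule symI) (auto intro: sym)
  show "trans (lat_cong M (coann M X))"
  proof (rule transI)
    fix x y z assume "(x, y) \<in> lat_cong M (coann M X)" "(y, z) \<in> lat_cong M (coann M X)"
    then obtain e d where *: "x \<in> carrier M" "y \<in> carrier M" "z \<in> carrier M"
      "e \<in> coann M X" "x \<sqinter> e = y \<sqinter> e" "d \<in> coann M X" "y \<sqinter> d = z \<sqinter> d"
      unfolding lat_cong_def by blast
    have ed: "e \<in> carrier M" "d \<in> carrier M" using * coann_subset by auto
    have "x \<sqinter> (e \<sqinter> d) = (y \<sqinter> e) \<sqinter> d" using * ed inf_assoc by metis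
    also have "\<dots> = (y \<sqinter> d) \<sqinter> e" using * ed inf_assoc inf_comm by metis
    also have "\<dots> = z \<sqinter> (e \<sqinter> d)" using * ed inf_assoc inf_comm by metis
    finally show "(x, z) \<in> lat_cong M (coann M X)"
      using * coann_inf[OF X] unfolding lat_cong_def by blast
  qed
qed

lemma lat_cong_inf:
  assumes X: "X \<subseteq> carrier M"
    and "(x, x') \<in> lat_cong M (coann M X)" "(y, y') \<in> lat_cong M (coann M X)"
  shows "(x \<sqinter> y, x' \<sqinter> y') \<in> lat_cong M (coann M X)"
proof -
  obtain e d where *: "x \<in> carrier M" "x' \<in> carrier M" "y \<in> carrier M" "y' \<in> carrier M"
    "e \<in> coann M X" "x \<sqinter> e = x' \<sqinter> e" "d \<in> coann M X" "y \<sqinter> d = y' \<sqinter> d"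
    using assms(2,3) unfolding lat_cong_def by blast
  have ed: "e \<in> carrier M" "d \<in> carrier M" using * coann_subset by auto
  have swap: "(u \<sqinter> v) \<sqinter> (e \<sqinter> d) = (u \<sqinter> e) \<sqinter> (v \<sqinter> d)"
    if "u \<in> carrier M" "v \<in> carrier M" for u v
    using that ed inf_assoc inf_comm inf_closed by metis
  have "(x \<sqinter> y) \<sqinter> (e \<sqinter> d) = (x' \<sqinter> y') \<sqinter> (e \<sqinter> d)"
    using swap * by simp
  then show ?thesis
    using * coann_inf[OF X] inf_closed unfolding lat_cong_def by blast
qed

lemma lat_cong_sup:
  assumes X: "X \<subseteq> carrier M"
    and "(x, x') \<in> lat_cong M (coann M X)" "(y, y') \<in> lat_cong M (coann M X)"
  shows "(x \<squnion> y, x' \<squnion> y') \<in> lat_cong M (coann M X)"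
proof -
  obtain e d where *: "x \<in> carrier M" "x' \<in> carrier M" "y \<in> carrier M" "y' \<in> carrier M"
    "e \<in> coann M X" "x \<sqinter> e = x' \<sqinter> e" "d \<in> coann M X" "y \<sqinter> d = y' \<sqinter> d"
    using assms(2,3) unfolding lat_cong_def by blast
  have "e \<in> carrier M" "d \<in> carrier M" using * coann_subset by auto
  then have ed: "e \<in> carrier M" "d \<in> carrier M" "e \<sqinter> d \<in> carrier M" using inf_closed by auto
  have x: "(e \<sqinter> d) \<sqinter> x = (e \<sqinter> d) \<sqinter> x'" using * ed inf_assoc inf_comm by metis
  have y: "(e \<sqinter> d) \<sqinter> y = (e \<sqinter> d) \<sqinter> y'" using * ed inf_assoc inf_comm by metis
  \<comment> \<open>Distributivity carries the agreement of the arguments below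
    \<open>e \<sqinter> d\<close> over to their joins.\<close>
  have "(e \<sqinter> d) \<sqinter> (x \<squnion> y) = (e \<sqinter> d) \<sqinter> (x' \<squnion> y')"
    using inf_sup_distrib * ed x y by metis
  then have "(x \<squnion> y) \<sqinter> (e \<sqinter> d) = (x' \<squnion> y') \<sqinter> (e \<sqinter> d)"
    using inf_comm sup_closed * ed by metis
  then show ?thesis
    using * coann_inf[OF X] sup_closed unfolding lat_cong_def by blast
qed

end

sublocale bounded_distrib_lattice_alg \<subseteq> H: hull_system M "lat_cong M"
proof unfold_locales
  fix X assume "X \<subseteq> carrier M"
  then show "equiv (carrier M) (lat_cong M (coann M X))" by (rule equiv_lat_cong)
next
  fix F G :: "'a set" assume "F \<subseteq> G"
  then show "lat_cong M F \<subseteq> lat_cong M G" by (auto simp: lat_cong_def)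
qed

section \<open>The lattice hull described by families of representatives\<close>

context bounded_distrib_lattice_alg
begin

lemma carrier_lat_hull:
  "carrier (lat_hull M) = {H.el \<C> a | \<C> a. \<C> \<in> partitions M \<and> a \<in> \<C> \<rightarrow> carrier M}"
  unfolding H.quotient_rel_eq[symmetric] H.rel_def
  by (simp add: lat_hull_def lat_dlim_def Let_def lat_prod_def lat_quot_def)

lemma lat_hull_sup:
  "\<lbrakk>\<C> \<in> partitions M; a \<in> \<C> \<rightarrow> carrier M; b \<in> \<C> \<rightarrow> carrier M\<rbrakk>
    \<Longrightarrow> H.el \<C> a \<squnion>\<^bsub>lat_hull M\<^esub> H.el \<C> b = H.el \<C> (\<lambda>C. a C \<squnion> b C)"
  using H.dlim_op_el[of "lsup M", OF sup_closed lat_cong_sup]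
  by (simp add: lat_hull_def lat_dlim_def Let_def H.rel_def lat_prod_def lat_quot_def)

lemma lat_hull_inf:
  "\<lbrakk>\<C> \<in> partitions M; a \<in> \<C> \<rightarrow> carrier M; b \<in> \<C> \<rightarrow> carrier M\<rbrakk>
    \<Longrightarrow> H.el \<C> a \<sqinter>\<^bsub>lat_hull M\<^esub> H.el \<C> b = H.el \<C> (\<lambda>C. a C \<sqinter> b C)"
  using H.dlim_op_el[of "linf M", OF inf_closed lat_cong_inf]
  by (simp add: lat_hull_def lat_dlim_def Let_def H.rel_def lat_prod_def lat_quot_def)

lemma lat_hull_zero: "\<C> \<in> partitions M \<Longrightarrow> lzero (lat_hull M) = H.el \<C> (\<lambda>_. lzero M)"
  using H.dlim_const_el[OF _ zero_closed]
  by (simp add: lat_hull_def lat_dlim_def Let_def H.rel_def lat_prod_def lat_quot_def)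

lemma lat_hull_one: "\<C> \<in> partitions M \<Longrightarrow> lone (lat_hull M) = H.el \<C> (\<lambda>_. lone M)"
  using H.dlim_const_el[OF _ one_closed]
  by (simp add: lat_hull_def lat_dlim_def Let_def H.rel_def lat_prod_def lat_quot_def)

end


section \<open>The hull of a residuated lattice\<close>

context residuated_lattice
begin

section \<open>Multiplication, residuation and powers\<close>

lemma mult_closed: "\<lbrakk>a \<in> carrier A; b \<in> carrier A\<rbrakk> \<Longrightarrow> a \<odot> b \<in> carrier A"
  using mult.m_closed by (simp add: mult_monoid_def)

lemma mult_assoc:
  "\<lbrakk>a \<in> carrier A; b \<in> carrier A; c \<in> carrier A\<rbrakk> \<Longrightarrow> (a \<odot> b) \<odot> c = a \<odot> (b \<odot> c)"
  using mult.m_assoc by (simp add: mult_monoid_def)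

lemma mult_comm: "\<lbrakk>a \<in> carrier A; b \<in> carrier A\<rbrakk> \<Longrightarrow> a \<odot> b = b \<odot> a"
  using mult.m_comm by (simp add: mult_monoid_def)

lemma mult_one: "a \<in> carrier A \<Longrightarrow> a \<odot> lone A = a"
  using mult.r_one by (simp add: mult_monoid_def)

lemma pow_closed: "a \<in> carrier A \<Longrightarrow> a [^]\<^bsub>mult_monoid A\<^esub> (n::nat) \<in> carrier A"
  using mult.nat_pow_closed by (simp add: mult_monoid_def)

lemma pow_add:
  "a \<in> carrier A \<Longrightarrow> a [^]\<^bsub>mult_monoid A\<^esub> (m + n :: nat) =
    a [^]\<^bsub>mult_monoid A\<^esub> m \<odot> a [^]\<^bsub>mult_monoid A\<^esub> n"
  using mult.nat_pow_mult by (simp add: mult_monoid_def)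

lemma pow_mult_distrib:
  "\<lbrakk>a \<in> carrier A; b \<in> carrier A\<rbrakk> \<Longrightarrow> (a \<odot> b) [^]\<^bsub>mult_monoid A\<^esub> (n::nat) =
    a [^]\<^bsub>mult_monoid A\<^esub> n \<odot> b [^]\<^bsub>mult_monoid A\<^esub> n"
  using mult.nat_pow_distrib by (simp add: mult_monoid_def)

lemma pow_1: "a \<in> carrier A \<Longrightarrow> a [^]\<^bsub>mult_monoid A\<^esub> (1::nat) = a"
  using mult.nat_pow_Suc[of a 0] mult.nat_pow_0 mult.l_one by (simp add: mult_monoid_def)

lemma mult_mono:
  assumes "a \<preceq> b" "a \<in> carrier A" "b \<in> carrier A" "c \<in> carrier A"
  shows "a \<odot> c \<preceq> b \<odot> c"
proof -
  \<comment> \<open>Residuation applied to \<open>b \<odot> c \<preceq> b \<odot> c\<close>;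
    anything below \<open>b\<close> inherits the bound.\<close>
  have "b \<preceq> c \<leadsto> (b \<odot> c)" using assms residuation mult_closed le_refl by simp
  then have "a \<preceq> c \<leadsto> (b \<odot> c)" using assms le_trans imp_closed mult_closed by meson
  then show ?thesis using assms residuation mult_closed by simp
qed

lemma mult_mono2:
  assumes "a \<preceq> b" "c \<preceq> d" "a \<in> carrier A" "b \<in> carrier A" "c \<in> carrier A" "d \<in> carrier A"
  shows "a \<odot> c \<preceq> b \<odot> d"
proof -
  have "a \<odot> c \<preceq> b \<odot> c" "c \<odot> b \<preceq> d \<odot> b" using mult_mono assms by auto
  then show ?thesis using mult_comm le_trans mult_closed assms by metis
qed

lemma mult_le1: "\<lbrakk>a \<in> carrier A; b \<in> carrier A\<rbrakk> \<Longrightarrow> a \<odot> b \<preceq> a"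
  using mult_mono2[OF le_refl one_greatest, of a b] mult_one one_closed by simp

lemma mult_le2: "\<lbrakk>a \<in> carrier A; b \<in> carrier A\<rbrakk> \<Longrightarrow> a \<odot> b \<preceq> b"
  using mult_le1 mult_comm by metis

text \<open>Residuation turns both hypotheses into \<open>a \<preceq> c \<leadsto> d\<close> and
  \<open>b \<preceq> c \<leadsto> d\<close>, where joins can be formed.\<close>

lemma sup_mult_le:
  assumes "a \<odot> c \<preceq> d" "b \<odot> c \<preceq> d"
    "a \<in> carrier A" "b \<in> carrier A" "c \<in> carrier A" "d \<in> carrier A"
  shows "(a \<squnion> b) \<odot> c \<preceq> d"
  using assms residuation sup_least sup_closed imp_closed by meson

lemma mult_le_weaken:
  "\<lbrakk>x \<odot> e \<preceq> y; d \<preceq> e; x \<in> carrier A; y \<in> carrier A; d \<in> carrier A; e \<in> carrier A\<rbrakk>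
    \<Longrightarrow> x \<odot> d \<preceq> y"
  by (meson mult_closed mult_mono2 le_refl le_trans)

lemma pow_antimono:
  fixes m n :: nat
  assumes "m \<le> n" "a \<in> carrier A"
  shows "a [^]\<^bsub>mult_monoid A\<^esub> n \<preceq> a [^]\<^bsub>mult_monoid A\<^esub> m"
  using pow_add[of a m "n - m"] mult_le1 pow_closed assms by simp

text \<open>Multiplying out \<open>(a \<squnion> x) \<odot> (b \<squnion> x)\<close> gives
  \<open>a \<odot> b\<close> and terms with a factor \<open>x\<close>, which lie below
  \<open>x\<close>. Hence \<open>1 = 1 \<odot> 1\<close> lies below
  \<open>(a \<odot> b) \<squnion> x\<close>.\<close>

lemma coann_mult:
  assumes "X \<subseteq> carrier A" "a \<in> coann A X" "b \<in> coann A X"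
  shows "a \<odot> b \<in> coann A X"
proof -
  have c: "a \<in> carrier A" "b \<in> carrier A" using assms coann_subset by auto
  have "(a \<odot> b) \<squnion> x = lone A" if x: "x \<in> X" for x
  proof -
    have xc: "x \<in> carrier A" and ax: "a \<squnion> x = lone A" and bx: "b \<squnion> x = lone A"
      using x assms unfolding coann_def by blast+
    let ?d = "(a \<odot> b) \<squnion> x"
    have d: "?d \<in> carrier A" "x \<preceq> ?d" "a \<odot> b \<preceq> ?d"
      using c xc mult_closed sup_closed sup_ge1 sup_ge2 by simp_all
    have le: "x \<odot> u \<preceq> ?d" "u \<odot> x \<preceq> ?d" if "u \<in> carrier A" for u
      using le_trans[OF mult_le1 d(2)] le_trans[OF mult_le2 d(2)] that xc d(1) mult_closed by simp_all
    have "b \<odot> a \<preceq> ?d" using d mult_comm c by metis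
    then have "(b \<squnion> x) \<odot> a \<preceq> ?d" using sup_mult_le le(1) c xc d by simp
    then have "a \<odot> (b \<squnion> x) \<preceq> ?d" using c xc mult_comm sup_closed by metis
    then have "(a \<squnion> x) \<odot> (b \<squnion> x) \<preceq> ?d" using sup_mult_le le(1) c xc d sup_closed by simp
    then show ?thesis using ax bx mult_one one_closed one_leD d by simp
  qed
  then show ?thesis using c mult_closed by (simp add: coann_def)
qed

lemma coann_pow:
  assumes "X \<subseteq> carrier A" "a \<in> coann A X"
  shows "a [^]\<^bsub>mult_monoid A\<^esub> (n::nat) \<in> coann A X"
proof (induction n)
  case 0
  then show ?case using one_in_coann assms by (simp add: mult_monoid_def)
next
  case (Suc n)
  then show ?case using coann_mult assms by (simp add: mult_monoid_def)
qed

text \<open>By residuation and commutativity, \<open>x \<odot> e \<preceq> y\<close> means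
  \<open>e \<preceq> x \<leadsto> y\<close>. So the meet of the two implications is itself a
  witness, and conversely every witness lies below it and upward closure applies.\<close>

lemma rlat_cong_iff:
  assumes X: "X \<subseteq> carrier A"
  shows "(x, y) \<in> rlat_cong A (coann A X) \<longleftrightarrow>
    x \<in> carrier A \<and> y \<in> carrier A \<and> (\<exists>e\<in>coann A X. x \<odot> e \<preceq> y \<and> y \<odot> e \<preceq> x)"
proof -
  have "(x \<leadsto> y) \<sqinter> (y \<leadsto> x) \<in> coann A X \<longleftrightarrow> (\<exists>e\<in>coann A X. x \<odot> e \<preceq> y \<and> y \<odot> e \<preceq> x)"
    (is "?i \<in> _ \<longleftrightarrow> _") if c: "x \<in> carrier A" "y \<in> carrier A"
  proof
    assume i: "?i \<in> coann A X"
    have ic: "x \<leadsto> y \<in> carrier A" "y \<leadsto> x \<in> carrier A" "?i \<in> carrier A"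
      using c imp_closed inf_closed by auto
    then have "?i \<odot> x \<preceq> y" "?i \<odot> y \<preceq> x"
      using residuation c inf_le1 inf_le2 by blast+
    then show "\<exists>e\<in>coann A X. x \<odot> e \<preceq> y \<and> y \<odot> e \<preceq> x"
      using i ic c mult_comm by metis
  next
    assume "\<exists>e\<in>coann A X. x \<odot> e \<preceq> y \<and> y \<odot> e \<preceq> x"
    then obtain e where e: "e \<in> coann A X" "x \<odot> e \<preceq> y" "y \<odot> e \<preceq> x" by blast
    then have ec: "e \<in> carrier A" using coann_subset by blast
    then have "e \<preceq> x \<leadsto> y" "e \<preceq> y \<leadsto> x" using e c residuation mult_comm by metis+
    then have "e \<preceq> ?i" using inf_greatest c ec imp_closed by blast
    then show "?i \<in> coann A X" using coann_upclosed[OF X e(1)] c imp_closed inf_closed by blast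
  qed
  then show ?thesis unfolding rlat_cong_def by blast
qed

lemma equiv_rlat_cong:
  assumes X: "X \<subseteq> carrier A"
  shows "equiv (carrier A) (rlat_cong A (coann A X))"
proof (rule equivI)
  show "rlat_cong A (coann A X) \<subseteq> carrier A \<times> carrier A" by (auto simp: rlat_cong_def)
  show "refl_on (carrier A) (rlat_cong A (coann A X))"
    using one_in_coann[OF X]
    by (intro refl_onI) (auto simp: rlat_cong_iff[OF X] mult_one le_refl intro!: bexI[of _ "lone A"])
  show "sym (rlat_cong A (coann A X))"
    by (rule symI) (auto simp: rlat_cong_iff[OF X])
  show "trans (rlat_cong A (coann A X))"
  proof (rule transI)
    fix x y z assume "(x, y) \<in> rlat_cong A (coann A X)" "(y, z) \<in> rlat_cong A (coann A X)"
    then obtain e d where *: "x \<in> carrier A" "y \<in> carrier A" "z \<in> carrier A"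
      "e \<in> coann A X" "x \<odot> e \<preceq> y" "y \<odot> e \<preceq> x" "d \<in> coann A X" "y \<odot> d \<preceq> z" "z \<odot> d \<preceq> y"
      unfolding rlat_cong_iff[OF X] by blast
    have ed: "e \<in> carrier A" "d \<in> carrier A" using * coann_subset by auto
    have "(x \<odot> e) \<odot> d \<preceq> y \<odot> d" "(z \<odot> d) \<odot> e \<preceq> y \<odot> e" using * ed mult_mono mult_closed by auto
    then have "(x \<odot> e) \<odot> d \<preceq> z" "(z \<odot> d) \<odot> e \<preceq> x"
      using * ed mult_closed le_trans by meson+
    then have "x \<odot> (e \<odot> d) \<preceq> z" "z \<odot> (e \<odot> d) \<preceq> x"
      using * ed mult_assoc mult_comm by metis+
    then show "(x, z) \<in> rlat_cong A (coann A X)"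
      using * coann_mult[OF X] unfolding rlat_cong_iff[OF X] by blast
  qed
qed

text \<open>The product of two witnesses lies below both and stays in the co-annihilator.\<close>

lemma rlat_cong_common:
  assumes X: "X \<subseteq> carrier A"
    and "(x, x') \<in> rlat_cong A (coann A X)" "(y, y') \<in> rlat_cong A (coann A X)"
  obtains e where "x \<in> carrier A" "x' \<in> carrier A" "y \<in> carrier A" "y' \<in> carrier A"
    "e \<in> carrier A" "e \<in> coann A X"
    "x \<odot> e \<preceq> x'" "x' \<odot> e \<preceq> x" "y \<odot> e \<preceq> y'" "y' \<odot> e \<preceq> y"
proof -
  obtain e d where *: "x \<in> carrier A" "x' \<in> carrier A" "y \<in> carrier A" "y' \<in> carrier A"
    "e \<in> coann A X" "x \<odot> e \<preceq> x'" "x' \<odot> e \<preceq> x" "d \<in> coann A X" "y \<odot> d \<preceq> y'" "y' \<odot> d \<preceq> y"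
    using assms(2,3) unfolding rlat_cong_iff[OF X] by blast
  have ed: "e \<in> carrier A" "d \<in> carrier A" "e \<odot> d \<in> carrier A" "e \<odot> d \<in> coann A X"
    using * coann_subset coann_mult[OF X] by blast+
  have le: "e \<odot> d \<preceq> e" "e \<odot> d \<preceq> d" using ed mult_le1 mult_le2 by auto
  show thesis
    using that[of "e \<odot> d"] * ed mult_le_weaken[OF _ le(1)] mult_le_weaken[OF _ le(2)] by blast
qed

lemma rlat_cong_inf:
  assumes X: "X \<subseteq> carrier A"
    and r: "(x, x') \<in> rlat_cong A (coann A X)" "(y, y') \<in> rlat_cong A (coann A X)"
  shows "(x \<sqinter> y, x' \<sqinter> y') \<in> rlat_cong A (coann A X)"
proof -
  obtain e where *: "x \<in> carrier A" "x' \<in> carrier A" "y \<in> carrier A" "y' \<in> carrier A"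
    "e \<in> carrier A" "e \<in> coann A X"
    "x \<odot> e \<preceq> x'" "x' \<odot> e \<preceq> x" "y \<odot> e \<preceq> y'" "y' \<odot> e \<preceq> y"
    by (rule rlat_cong_common[OF X r])
  have "(u \<sqinter> v) \<odot> e \<preceq> u' \<sqinter> v'" if "u \<in> carrier A" "v \<in> carrier A" "u' \<in> carrier A" "v' \<in> carrier A"
    "u \<odot> e \<preceq> u'" "v \<odot> e \<preceq> v'" for u v u' v'
  proof -
    have "(u \<sqinter> v) \<odot> e \<preceq> u \<odot> e" "(u \<sqinter> v) \<odot> e \<preceq> v \<odot> e"
      using mult_mono that * inf_le1 inf_le2 inf_closed by auto
    then have "(u \<sqinter> v) \<odot> e \<preceq> u'" "(u \<sqinter> v) \<odot> e \<preceq> v'"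
      using that * mult_closed inf_closed le_trans by meson+
    then show ?thesis using that * mult_closed inf_closed inf_greatest by meson
  qed
  then show ?thesis using * inf_closed unfolding rlat_cong_iff[OF X] by blast
qed

lemma rlat_cong_sup:
  assumes X: "X \<subseteq> carrier A"
    and r: "(x, x') \<in> rlat_cong A (coann A X)" "(y, y') \<in> rlat_cong A (coann A X)"
  shows "(x \<squnion> y, x' \<squnion> y') \<in> rlat_cong A (coann A X)"
proof -
  obtain e where *: "x \<in> carrier A" "x' \<in> carrier A" "y \<in> carrier A" "y' \<in> carrier A"
    "e \<in> carrier A" "e \<in> coann A X"
    "x \<odot> e \<preceq> x'" "x' \<odot> e \<preceq> x" "y \<odot> e \<preceq> y'" "y' \<odot> e \<preceq> y"
    by (rule rlat_cong_common[OF X r])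
  have "(u \<squnion> v) \<odot> e \<preceq> u' \<squnion> v'" if "u \<in> carrier A" "v \<in> carrier A" "u' \<in> carrier A" "v' \<in> carrier A"
    "u \<odot> e \<preceq> u'" "v \<odot> e \<preceq> v'" for u v u' v'
  proof -
    have "u \<odot> e \<preceq> u' \<squnion> v'" "v \<odot> e \<preceq> u' \<squnion> v'"
      using that * mult_closed sup_closed le_trans sup_ge1 sup_ge2 by meson+
    then show ?thesis using that * sup_closed sup_mult_le by meson
  qed
  then show ?thesis using * sup_closed unfolding rlat_cong_iff[OF X] by blast
qed

lemma rlat_cong_mult:
  assumes X: "X \<subseteq> carrier A"
    and r: "(x, x') \<in> rlat_cong A (coann A X)" "(y, y') \<in> rlat_cong A (coann A X)"
  shows "(x \<odot> y, x' \<odot> y') \<in> rlat_cong A (coann A X)"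
proof -
  obtain e where *: "x \<in> carrier A" "x' \<in> carrier A" "y \<in> carrier A" "y' \<in> carrier A"
    "e \<in> carrier A" "e \<in> coann A X"
    "x \<odot> e \<preceq> x'" "x' \<odot> e \<preceq> x" "y \<odot> e \<preceq> y'" "y' \<odot> e \<preceq> y"
    by (rule rlat_cong_common[OF X r])
  \<comment> \<open>Each factor consumes one copy of \<open>e\<close>, so the witness for the
    product is \<open>e \<odot> e\<close>.\<close>
  have "(u \<odot> v) \<odot> (e \<odot> e) \<preceq> u' \<odot> v'"
    if "u \<in> carrier A" "v \<in> carrier A" "u' \<in> carrier A" "v' \<in> carrier A"
    "u \<odot> e \<preceq> u'" "v \<odot> e \<preceq> v'" for u v u' v'
  proof -
    have "(u \<odot> v) \<odot> (e \<odot> e) = (u \<odot> e) \<odot> (v \<odot> e)"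
      using that * mult_assoc mult_comm mult_closed by metis
    then show ?thesis using mult_mono2 that * mult_closed by simp
  qed
  then have "(x \<odot> y) \<odot> (e \<odot> e) \<preceq> x' \<odot> y'" "(x' \<odot> y') \<odot> (e \<odot> e) \<preceq> x \<odot> y"
    using * by simp_all
  moreover have "e \<odot> e \<in> coann A X" using coann_mult[OF X] * by simp
  ultimately show ?thesis using * mult_closed unfolding rlat_cong_iff[OF X] by blast
qed

end

sublocale residuated_lattice \<subseteq> R: hull_system A "rlat_cong A"
proof unfold_locales
  fix X assume "X \<subseteq> carrier A"
  then show "equiv (carrier A) (rlat_cong A (coann A X))" by (rule equiv_rlat_cong)
next
  fix F G :: "'a set" assume "F \<subseteq> G"
  then show "rlat_cong A F \<subseteq> rlat_cong A G" by (auto simp: rlat_cong_def)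
qed

section \<open>The residuated hull described by families of representatives\<close>

context residuated_lattice
begin

text \<open>Residuated products and quotients have the same carriers as their lattice
  reducts.\<close>

lemma rlat_hull_rel:
  "dlim_rel (partitions A) refined_by
     (\<lambda>\<C>. rlat_prod \<C> (\<lambda>C. rlat_quot A (rlat_cong A (coann A C)))) (transition A (rlat_cong A)) = R.rel"
  unfolding R.rel_def dlim_rel_def
  by (simp add: rlat_prod_def rlat_quot_def lat_prod_def lat_quot_def lat.defs rlat.defs)

lemmas rlat_hull_simps = rlat_hull_def rlat_dlim_def lat_dlim_def Let_def rlat_hull_rel
  rlat_prod_def rlat_quot_def lat_prod_def lat_quot_def lat.defs rlat.defs

lemma carrier_rlat_hull:
  "carrier (rlat_hull A) = {R.el \<C> a | \<C> a. \<C> \<in> partitions A \<and> a \<in> \<C> \<rightarrow> carrier A}"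
  unfolding R.quotient_rel_eq[symmetric]
  using rlat_hull_rel
  by (simp add: rlat_hull_simps)

lemma rlat_hull_sup:
  "\<lbrakk>\<C> \<in> partitions A; a \<in> \<C> \<rightarrow> carrier A; b \<in> \<C> \<rightarrow> carrier A\<rbrakk>
    \<Longrightarrow> R.el \<C> a \<squnion>\<^bsub>rlat_hull A\<^esub> R.el \<C> b = R.el \<C> (\<lambda>C. a C \<squnion> b C)"
  using R.dlim_op_el[of "lsup A", OF sup_closed rlat_cong_sup] rlat_hull_rel
  by (simp add: rlat_hull_simps)

lemma rlat_hull_inf:
  "\<lbrakk>\<C> \<in> partitions A; a \<in> \<C> \<rightarrow> carrier A; b \<in> \<C> \<rightarrow> carrier A\<rbrakk>
    \<Longrightarrow> R.el \<C> a \<sqinter>\<^bsub>rlat_hull A\<^esub> R.el \<C> b = R.el \<C> (\<lambda>C. a C \<sqinter> b C)"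
  using R.dlim_op_el[of "linf A", OF inf_closed rlat_cong_inf] rlat_hull_rel
  by (simp add: rlat_hull_simps)

lemma rlat_hull_mult:
  "\<lbrakk>\<C> \<in> partitions A; a \<in> \<C> \<rightarrow> carrier A; b \<in> \<C> \<rightarrow> carrier A\<rbrakk>
    \<Longrightarrow> R.el \<C> a \<odot>\<^bsub>rlat_hull A\<^esub> R.el \<C> b = R.el \<C> (\<lambda>C. a C \<odot> b C)"
  using R.dlim_op_el[of "rmult A", OF mult_closed rlat_cong_mult] rlat_hull_rel
  by (simp add: rlat_hull_simps)

lemma rlat_hull_zero: "\<C> \<in> partitions A \<Longrightarrow> lzero (rlat_hull A) = R.el \<C> (\<lambda>_. lzero A)"
  using R.dlim_const_el[OF _ zero_closed] rlat_hull_rel by (simp add: rlat_hull_simps)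

lemma rlat_hull_one: "\<C> \<in> partitions A \<Longrightarrow> lone (rlat_hull A) = R.el \<C> (\<lambda>_. lone A)"
  using R.dlim_const_el[OF _ one_closed] rlat_hull_rel by (simp add: rlat_hull_simps)

text \<open>A reticulation of the hull refers to powers taken in the hull; the recursion for powers
  reduces them to the componentwise multiplication.\<close>

lemma rlat_hull_pow:
  assumes "\<C> \<in> partitions A" "a \<in> \<C> \<rightarrow> carrier A"
  shows "R.el \<C> a [^]\<^bsub>mult_monoid (rlat_hull A)\<^esub> (n::nat) =
    R.el \<C> (\<lambda>C. a C [^]\<^bsub>mult_monoid A\<^esub> n)"
proof (induction n)
  case 0
  then show ?case using rlat_hull_one[OF assms(1)] by (simp add: nat_pow_def mult_monoid_def)
next
  case (Suc n)
  have p: "(\<lambda>C. a C [^]\<^bsub>mult_monoid A\<^esub> n) \<in> \<C> \<rightarrow> carrier A"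
    using assms pow_closed by (auto simp: Pi_iff)
  have "R.el \<C> a [^]\<^bsub>mult_monoid (rlat_hull A)\<^esub> Suc n =
      R.el \<C> a [^]\<^bsub>mult_monoid (rlat_hull A)\<^esub> n \<odot>\<^bsub>rlat_hull A\<^esub> R.el \<C> a"
    by (simp add: nat_pow_def mult_monoid_def)
  also have "\<dots> = R.el \<C> (\<lambda>C. a C [^]\<^bsub>mult_monoid A\<^esub> n \<odot> a C)"
    unfolding Suc by (rule rlat_hull_mult[OF assms(1) p assms(2)])
  also have "\<dots> = R.el \<C> (\<lambda>C. a C [^]\<^bsub>mult_monoid A\<^esub> Suc n)"
    by (simp add: mult_monoid_def)
  finally show ?case .
qed

end


section \<open>Co-annihilators under a reticulation\<close>

locale reticulated_lattice = residuated_lattice A + reticulation A L lam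
  for A :: "('a, 'm) rlat_scheme" (structure) and L :: "('b, 'n) lat_scheme" and lam :: "'a \<Rightarrow> 'b"
begin

lemma lam_closed: "a \<in> carrier A \<Longrightarrow> lam a \<in> carrier L"
  using surj by blast

lemma lam_mono:
  assumes "a \<preceq> b" "a \<in> carrier A" "b \<in> carrier A"
  shows "lam a \<preceq>\<^bsub>L\<^esub> lam b"
proof -
  have "a [^]\<^bsub>mult_monoid A\<^esub> (1::nat) \<preceq> b" using assms pow_1 by simp
  then show ?thesis using map_le_iff assms by blast
qed

text \<open>One inequality comes from \<open>a^n \<preceq> a\<close>; for the other, the exponent
  \<open>n\<close> itself satisfies the order condition by reflexivity.\<close>

lemma lam_pow:
  assumes "a \<in> carrier A" "n \<ge> (1::nat)"
  shows "lam (a [^]\<^bsub>mult_monoid A\<^esub> n) = lam a"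
proof (rule L.le_antisym)
  have "a [^]\<^bsub>mult_monoid A\<^esub> n \<preceq> a" using pow_antimono[OF assms(2,1)] pow_1 assms(1) by simp
  then show "lam (a [^]\<^bsub>mult_monoid A\<^esub> n) \<preceq>\<^bsub>L\<^esub> lam a" using lam_mono pow_closed assms by blast
  show "lam a \<preceq>\<^bsub>L\<^esub> lam (a [^]\<^bsub>mult_monoid A\<^esub> n)"
    using map_le_iff[of a "a [^]\<^bsub>mult_monoid A\<^esub> n"] pow_closed assms le_refl by blast
qed (use lam_closed pow_closed assms in blast)+

text \<open>All powers of 1 are 1, so 1 being below \<open>a\<close> after applying
  \<open>lam\<close> already forces it to be below \<open>a\<close> in \<open>A\<close>.\<close>

lemma lam_eq_one_iff:
  assumes a: "a \<in> carrier A"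
  shows "lam a = lone L \<longleftrightarrow> a = lone A"
proof
  assume "lam a = lone L"
  then have "lam (lone A) \<preceq>\<^bsub>L\<^esub> lam a" using L.le_refl L.one_closed by (simp add: map_one)
  then obtain n :: nat where "lone A [^]\<^bsub>mult_monoid A\<^esub> n \<preceq> a"
    using map_le_iff[OF one_closed a] by blast
  moreover have "lone A [^]\<^bsub>mult_monoid A\<^esub> n = lone A"
    using mult.nat_pow_one by (simp add: mult_monoid_def)
  ultimately show "a = lone A" using one_leD a by simp
qed (simp add: map_one)

lemma lam_sup_eq_one_iff:
  "\<lbrakk>a \<in> carrier A; b \<in> carrier A\<rbrakk> \<Longrightarrow> lam a \<squnion>\<^bsub>L\<^esub> lam b = lone L \<longleftrightarrow> a \<squnion> b = lone A"
  using lam_eq_one_iff[OF sup_closed] map_sup by metis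

text \<open>Inverse of taking images under \<open>lam\<close> on co-annihilators; cut down to the
  carrier because \<open>lam\<close> is unconstrained elsewhere.\<close>

definition pre :: "'b set \<Rightarrow> 'a set" where
  "pre K = carrier A \<inter> lam -` K"

lemma pre_subset: "pre K \<subseteq> carrier A"
  by (simp add: pre_def)

lemma lam_image_pre: "K \<subseteq> carrier L \<Longrightarrow> lam ` pre K = K"
  unfolding pre_def surj[symmetric] by blast

lemma lam_in_coann_iff:
  assumes "X \<subseteq> carrier A" "a \<in> carrier A"
  shows "lam a \<in> coann L (lam ` X) \<longleftrightarrow> a \<in> coann A X"
proof -
  have "lam a \<squnion>\<^bsub>L\<^esub> lam x = lone L \<longleftrightarrow> a \<squnion> x = lone A" if "x \<in> X" for x
    using lam_sup_eq_one_iff assms that by blast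
  then show ?thesis using assms lam_closed unfolding coann_def by simp
qed

lemma pre_coann: "X \<subseteq> carrier A \<Longrightarrow> pre (coann L (lam ` X)) = coann A X"
  unfolding pre_def using lam_in_coann_iff coann_subset by blast

lemma lam_image_coann: "X \<subseteq> carrier A \<Longrightarrow> lam ` coann A X = coann L (lam ` X)"
  using pre_coann lam_image_pre[OF L.coann_subset] by metis

lemma lam_CoAnn: "C \<in> CoAnn A \<Longrightarrow> lam ` C \<in> CoAnn L"
proof -
  assume "C \<in> CoAnn A"
  then obtain X where X: "X \<subseteq> carrier A" "C = coann A X" unfolding CoAnn_def by blast
  then have "lam ` X \<subseteq> carrier L" using lam_closed by blast
  then show ?thesis using X lam_image_coann unfolding CoAnn_def by blast
qed

text \<open>Co-annihilators are saturated for the kernel of \<open>lam\<close>, so passing to images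
  is injective on them.\<close>

lemma pre_lam_image: "C \<in> CoAnn A \<Longrightarrow> pre (lam ` C) = C"
  unfolding CoAnn_def using lam_image_coann pre_coann by auto

lemma pre_CoAnn: "K \<in> CoAnn L \<Longrightarrow> pre K \<in> CoAnn A"
proof -
  assume "K \<in> CoAnn L"
  then obtain Y where Y: "Y \<subseteq> carrier L" "K = coann L Y" unfolding CoAnn_def by blast
  then have "pre K = coann A (pre Y)" using pre_coann[OF pre_subset] lam_image_pre by metis
  then show ?thesis using pre_subset unfolding CoAnn_def by blast
qed

lemma lam_image_subset_iff:
  "\<lbrakk>C \<in> CoAnn A; D \<in> CoAnn A\<rbrakk> \<Longrightarrow> lam ` D \<subseteq> lam ` C \<longleftrightarrow> D \<subseteq> C"
  using pre_lam_image unfolding pre_def by blast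

text \<open>Saturation of \<open>D\<close> places any \<open>c\<close> in \<open>C\<close> with the
  same image as some element of \<open>D\<close> into \<open>D\<close> itself.\<close>

lemma lam_image_Int:
  assumes "C \<in> CoAnn A" "D \<in> CoAnn A"
  shows "lam ` C \<inter> lam ` D = lam ` (C \<inter> D)"
proof -
  have "c \<in> D" if "c \<in> C" "d \<in> D" "lam c = lam d" for c d
  proof -
    have "c \<in> pre (lam ` D)" using that CoAnn_subset[OF assms(1)] unfolding pre_def by auto
    then show ?thesis using pre_lam_image[OF assms(2)] by simp
  qed
  then show ?thesis by blast
qed

lemma lam_image_eq_one_iff:
  assumes "C \<in> CoAnn A"
  shows "lam ` C = {lone L} \<longleftrightarrow> C = {lone A}"
proof
  assume "lam ` C = {lone L}"
  then have "C \<subseteq> {lone A}" using lam_eq_one_iff CoAnn_subset[OF assms] by blast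
  then show "C = {lone A}" using one_in_CoAnn[OF assms] by blast
qed (simp add: map_one)

text \<open>The four clauses of \<open>partitions_iff\<close> are matched one by one. Assuming only
  a family of co-annihilators makes the equivalence usable for images and for preimages of
  partitions.\<close>

lemma lam_partition_iff:
  assumes C: "\<C> \<subseteq> CoAnn A"
  shows "(`) lam ` \<C> \<in> partitions L \<longleftrightarrow> \<C> \<in> partitions A"
proof -
  have inj: "inj_on ((`) lam) \<C>"
    using pre_lam_image C by (intro inj_on_inverseI[of _ pre]) blast
  then have fin: "finite ((`) lam ` \<C>) \<longleftrightarrow> finite \<C>" by (rule finite_image_iff)
  have "lam ` X \<in> CoAnn L - {{lone L}} \<longleftrightarrow> X \<in> CoAnn A - {{lone A}}" if "X \<in> \<C>" for X
  proof -
    have "X \<in> CoAnn A" using that C by blast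
    then show ?thesis using lam_CoAnn lam_image_eq_one_iff by simp
  qed
  then have sub: "(`) lam ` \<C> \<subseteq> CoAnn L - {{lone L}} \<longleftrightarrow> \<C> \<subseteq> CoAnn A - {{lone A}}"
    unfolding image_subset_iff by blast
  have "lam ` X \<inter> lam ` Y = {lone L} \<longleftrightarrow> X \<inter> Y = {lone A}" if "X \<in> \<C>" "Y \<in> \<C>" for X Y
  proof -
    have XY: "X \<in> CoAnn A" "Y \<in> CoAnn A" using that C by auto
    then show ?thesis using lam_image_Int lam_image_eq_one_iff[OF CoAnn_Int] by simp
  qed
  then have dis: "(\<forall>C\<in>(`) lam ` \<C>. \<forall>D\<in>(`) lam ` \<C>. C \<noteq> D \<longrightarrow> C \<inter> D = {lone L}) \<longleftrightarrow>
      (\<forall>C\<in>\<C>. \<forall>D\<in>\<C>. C \<noteq> D \<longrightarrow> C \<inter> D = {lone A})"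
    using inj by (simp add: inj_on_eq_iff)
  have one: "lam x \<squnion>\<^bsub>L\<^esub> lam c = lone L \<longleftrightarrow> x \<squnion> c = lone A"
    if "x \<in> carrier A" "X \<in> \<C>" "c \<in> X" for x X c
    using lam_sup_eq_one_iff that C CoAnn_subset by blast
  \<comment> \<open>Surjectivity of \<open>lam\<close> lets the quantifiers over \<open>L\<close>
    run over images of elements of \<open>A\<close>.\<close>
  have "(\<forall>y\<in>carrier L. (\<forall>K\<in>(`) lam ` \<C>. \<forall>k\<in>K. y \<squnion>\<^bsub>L\<^esub> k = lone L) \<longrightarrow> y = lone L) \<longleftrightarrow>
      (\<forall>x\<in>carrier A. (\<forall>X\<in>\<C>. \<forall>c\<in>X. lam x \<squnion>\<^bsub>L\<^esub> lam c = lone L) \<longrightarrow> lam x = lone L)"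
    unfolding surj[symmetric] by simp
  also have "\<dots> \<longleftrightarrow> (\<forall>x\<in>carrier A. (\<forall>X\<in>\<C>. \<forall>c\<in>X. x \<squnion> c = lone A) \<longrightarrow> x = lone A)"
    using one lam_eq_one_iff by simp
  finally show ?thesis
    unfolding partitions_iff L.partitions_iff fin sub dis by simp
qed

lemma lam_partition: "\<C> \<in> partitions A \<Longrightarrow> (`) lam ` \<C> \<in> partitions L"
  using lam_partition_iff partition_memD(1) by blast

text \<open>The preimages under \<open>lam\<close> form the required partition, since their images
  give back \<open>\<K>\<close>.\<close>

lemma partition_eq_lam_image:
  assumes K: "\<K> \<in> partitions L"
  obtains \<C> where "\<C> \<in> partitions A" "\<K> = (`) lam ` \<C>"
proof
  show e: "\<K> = (`) lam ` pre ` \<K>"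
    using lam_image_pre L.partition_memD(2)[OF K] by (force simp: image_image)
  have "pre ` \<K> \<subseteq> CoAnn A" using pre_CoAnn L.partition_memD(1)[OF K] by blast
  then show "pre ` \<K> \<in> partitions A" using lam_partition_iff K e by metis
qed

lemma lam_refined_iff:
  assumes "\<C> \<in> partitions A" "\<D> \<in> partitions A"
  shows "refined_by ((`) lam ` \<C>) ((`) lam ` \<D>) \<longleftrightarrow> refined_by \<C> \<D>"
proof -
  have "lam ` D \<subseteq> lam ` C \<longleftrightarrow> D \<subseteq> C" if "C \<in> \<C>" "D \<in> \<D>" for C D
    using lam_image_subset_iff partition_memD(1) assms that by blast
  then show ?thesis unfolding refined_by_def by simp
qed

lemma lam_par:
  assumes "\<C> \<in> partitions A" "\<E> \<in> partitions A" "refined_by \<C> \<E>" "E \<in> \<E>"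
  shows "L.H.par ((`) lam ` \<C>) (lam ` E) = lam ` R.par \<C> E"
  using R.par_mem[OF assms] assms(4)
  by (intro L.H.par_eq[OF lam_partition lam_partition, OF assms(1,2)]) auto


section \<open>Comparison of the two hulls\<close>

text \<open>The left side says that \<open>x\<close> is below \<open>y\<close> in the quotient,
  written as \<open>lat_le\<close> unfolds it; the right side is the form to which
  \<open>lam\<close> can be applied.\<close>

lemma rlat_cong_inf_iff:
  assumes X: "X \<subseteq> carrier A" and "x \<in> carrier A" "y \<in> carrier A"
  shows "(x \<sqinter> y, x) \<in> rlat_cong A (coann A X) \<longleftrightarrow> (\<exists>e\<in>coann A X. x \<odot> e \<preceq> y)"
proof -
  have "(x \<sqinter> y) \<odot> e \<preceq> x \<and> x \<odot> e \<preceq> x \<sqinter> y \<longleftrightarrow> x \<odot> e \<preceq> y" if "e \<in> coann A X" for e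
  proof -
    have e: "e \<in> carrier A" using that coann_subset by blast
    have c: "x \<sqinter> y \<in> carrier A" "x \<odot> e \<in> carrier A" "(x \<sqinter> y) \<odot> e \<in> carrier A"
      using e assms inf_closed mult_closed by simp_all
    have "(x \<sqinter> y) \<odot> e \<preceq> x"
      using le_trans[OF mult_le1 inf_le1] e c assms by simp
    moreover have "x \<odot> e \<preceq> x \<sqinter> y" if "x \<odot> e \<preceq> y"
      using inf_greatest[OF mult_le1 that] e c assms by simp
    moreover have "x \<odot> e \<preceq> y" if "x \<odot> e \<preceq> x \<sqinter> y"
      using le_trans[OF that inf_le2] e c assms by simp
    ultimately show ?thesis by blast
  qed
  then show ?thesis using assms inf_closed unfolding rlat_cong_iff[OF X] by blast
qed

text \<open>Applying \<open>lam\<close> to \<open>a^n \<odot> e\<close> removes the exponent.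
  Conversely the order condition for \<open>a \<odot> e\<close> gives
  \<open>a^n \<odot> e^n \<preceq> b\<close>, and \<open>e^n\<close> is again in the
  co-annihilator.\<close>

lemma coann_pow_le_iff:
  assumes X: "X \<subseteq> carrier A" and a: "a \<in> carrier A" and b: "b \<in> carrier A"
  shows "(\<exists>n::nat. n \<ge> 1 \<and> (\<exists>e\<in>coann A X. a [^]\<^bsub>mult_monoid A\<^esub> n \<odot> e \<preceq> b)) \<longleftrightarrow>
    (\<exists>k\<in>coann L (lam ` X). lam a \<sqinter>\<^bsub>L\<^esub> k \<preceq>\<^bsub>L\<^esub> lam b)"
proof
  assume "\<exists>n::nat. n \<ge> 1 \<and> (\<exists>e\<in>coann A X. a [^]\<^bsub>mult_monoid A\<^esub> n \<odot> e \<preceq> b)"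
  then obtain n :: nat and e where n: "n \<ge> 1" "e \<in> coann A X" "a [^]\<^bsub>mult_monoid A\<^esub> n \<odot> e \<preceq> b"
    by blast
  then have e: "e \<in> carrier A" using coann_subset by blast
  have "lam (a [^]\<^bsub>mult_monoid A\<^esub> n \<odot> e) \<preceq>\<^bsub>L\<^esub> lam b"
    using lam_mono[OF n(3)] mult_closed pow_closed a b e by simp
  then have "lam a \<sqinter>\<^bsub>L\<^esub> lam e \<preceq>\<^bsub>L\<^esub> lam b"
    using map_mult pow_closed lam_pow a e n(1) by simp
  moreover have "lam e \<in> coann L (lam ` X)" using lam_in_coann_iff X e n(2) by simp
  ultimately show "\<exists>k\<in>coann L (lam ` X). lam a \<sqinter>\<^bsub>L\<^esub> k \<preceq>\<^bsub>L\<^esub> lam b" by blast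
next
  assume "\<exists>k\<in>coann L (lam ` X). lam a \<sqinter>\<^bsub>L\<^esub> k \<preceq>\<^bsub>L\<^esub> lam b"
  then obtain k where k: "k \<in> lam ` coann A X" "lam a \<sqinter>\<^bsub>L\<^esub> k \<preceq>\<^bsub>L\<^esub> lam b"
    unfolding lam_image_coann[OF X] by (elim bexE)
  then obtain e where e: "e \<in> coann A X" "k = lam e" by (elim imageE)
  then have ec: "e \<in> carrier A" using coann_subset by blast
  then have "lam (a \<odot> e) \<preceq>\<^bsub>L\<^esub> lam b" using e k map_mult a by simp
  then obtain n :: nat where "n \<ge> 1" "(a \<odot> e) [^]\<^bsub>mult_monoid A\<^esub> n \<preceq> b"
    using map_le_iff[OF mult_closed[OF a ec] b] by auto
  then show "\<exists>n::nat. n \<ge> 1 \<and> (\<exists>e\<in>coann A X. a [^]\<^bsub>mult_monoid A\<^esub> n \<odot> e \<preceq> b)"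
    using pow_mult_distrib[OF a ec] coann_pow[OF X e(1)] by metis
qed

text \<open>Order of the images of two families at a stage of the lattice hull, phrased with
  partitions of \<open>A\<close> so that both hulls can be compared with it.\<close>

definition hull_le :: "'a set set \<Rightarrow> ('a set \<Rightarrow> 'a) \<Rightarrow> ('a set \<Rightarrow> 'a) \<Rightarrow> 'a set set \<Rightarrow> bool" where
  "hull_le \<C> a b \<E> \<longleftrightarrow> (\<forall>E\<in>\<E>. \<exists>k\<in>coann L (lam ` E). lam (a (R.par \<C> E)) \<sqinter>\<^bsub>L\<^esub> k \<preceq>\<^bsub>L\<^esub> lam (b (R.par \<C> E)))"

lemma hull_le_refine:
  assumes "hull_le \<C> a b \<E>" "refined_by \<C> \<E>" "refined_by \<E> \<F>"
    "\<C> \<in> partitions A" "\<E> \<in> partitions A" "\<F> \<in> partitions A"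
  shows "hull_le \<C> a b \<F>"
  unfolding hull_le_def
proof
  fix F assume F: "F \<in> \<F>"
  let ?E = "R.par \<E> F"
  have E: "?E \<in> \<E>" "F \<subseteq> ?E" using R.par_mem F assms by auto
  have "coann L (lam ` ?E) \<subseteq> coann L (lam ` F)" using E by (intro L.coann_antimono image_mono)
  moreover have "R.par \<C> ?E = R.par \<C> F" using R.par_par[OF assms(4-6,2,3) F] .
  moreover obtain k where "k \<in> coann L (lam ` ?E)"
    "lam (a (R.par \<C> ?E)) \<sqinter>\<^bsub>L\<^esub> k \<preceq>\<^bsub>L\<^esub> lam (b (R.par \<C> ?E))"
    using bspec[OF assms(1)[unfolded hull_le_def] E(1)] by (elim bexE)
  ultimately show "\<exists>k\<in>coann L (lam ` F).
      lam (a (R.par \<C> F)) \<sqinter>\<^bsub>L\<^esub> k \<preceq>\<^bsub>L\<^esub> lam (b (R.par \<C> F))"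
    by (intro bexI[of _ k]) auto
qed

text \<open>The quantifiers differ: \<open>hull_le\<close> leaves each member of \<open>\<E>\<close>
  its own exponent, while an inequality in the hull has a single one. Finiteness of the partition
  bridges the gap.\<close>

lemma hull_le_iff:
  assumes C: "\<C> \<in> partitions A" and a: "a \<in> \<C> \<rightarrow> carrier A" and b: "b \<in> \<C> \<rightarrow> carrier A"
    and E: "\<E> \<in> partitions A" and r: "refined_by \<C> \<E>"
  shows "hull_le \<C> a b \<E> \<longleftrightarrow> (\<exists>n::nat. n \<ge> 1 \<and>
    (\<forall>E\<in>\<E>. (a (R.par \<C> E) [^]\<^bsub>mult_monoid A\<^esub> n \<sqinter> b (R.par \<C> E),
       a (R.par \<C> E) [^]\<^bsub>mult_monoid A\<^esub> n) \<in> R.q E))"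
proof -
  let ?P = "\<lambda>(n::nat) E. \<exists>e\<in>coann A E. a (R.par \<C> E) [^]\<^bsub>mult_monoid A\<^esub> n \<odot> e \<preceq> b (R.par \<C> E)"
  have c: "a (R.par \<C> E) \<in> carrier A" "b (R.par \<C> E) \<in> carrier A" "E \<subseteq> carrier A" if "E \<in> \<E>" for E
    using R.par_mem[OF C E r that] a b partition_memD(2)[OF E that] by auto
  \<comment> \<open>Raising the exponent decreases the power, so the inequality persists for all
    larger exponents.\<close>
  have mono: "?P m E" if "?P n E" "n \<le> m" "E \<in> \<E>" for m n E
  proof -
    obtain e where e: "e \<in> coann A E" "a (R.par \<C> E) [^]\<^bsub>mult_monoid A\<^esub> n \<odot> e \<preceq> b (R.par \<C> E)"
      using \<open>?P n E\<close> by blast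
    then have ec: "e \<in> carrier A" using coann_subset by blast
    have p: "a (R.par \<C> E) [^]\<^bsub>mult_monoid A\<^esub> m \<preceq> a (R.par \<C> E) [^]\<^bsub>mult_monoid A\<^esub> n"
      using pow_antimono that c by blast
    have "a (R.par \<C> E) [^]\<^bsub>mult_monoid A\<^esub> m \<odot> e \<preceq> b (R.par \<C> E)"
      by (rule le_trans[OF mult_mono[OF p] e(2)]) (use c[OF that(3)] ec mult_closed pow_closed in simp_all)
    then show ?thesis using e(1) by blast
  qed
  have "hull_le \<C> a b \<E> \<longleftrightarrow> (\<forall>E\<in>\<E>. \<exists>n\<ge>1. ?P n E)"
    unfolding hull_le_def using coann_pow_le_iff c by (simp cong: ball_cong)
  also have "\<dots> \<longleftrightarrow> (\<exists>n\<ge>1. \<forall>E\<in>\<E>. ?P n E)"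
  proof
    assume *: "\<forall>E\<in>\<E>. \<exists>n\<ge>1. ?P n E"
    \<comment> \<open>Each condition therefore holds eventually, and finitely many eventual
      conditions hold eventually together.\<close>
    have "\<forall>E\<in>\<E>. eventually (\<lambda>n. ?P n E) sequentially"
    proof
      fix E assume "E \<in> \<E>"
      then show "eventually (\<lambda>n. ?P n E) sequentially"
        unfolding eventually_sequentially using * mono by meson
    qed
    moreover have "finite \<E>" using E by (simp add: partitions_iff)
    ultimately have "eventually (\<lambda>n. \<forall>E\<in>\<E>. ?P n E) sequentially"
      by (rule eventually_ball_finite[rotated])
    then obtain N where "\<forall>n\<ge>N. \<forall>E\<in>\<E>. ?P n E" unfolding eventually_sequentially by blast
    \<comment> \<open>Taking \<open>max 1 N\<close> keeps the exponent at least 1 even when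
      \<open>N\<close> is 0.\<close>
    then have "\<forall>E\<in>\<E>. ?P (max 1 N) E" by simp
    then show "\<exists>n\<ge>1. \<forall>E\<in>\<E>. ?P n E" by (meson max.cobounded1)
  qed blast
  also have "\<dots> \<longleftrightarrow> (\<exists>n\<ge>(1::nat). \<forall>E\<in>\<E>. (a (R.par \<C> E) [^]\<^bsub>mult_monoid A\<^esub> n \<sqinter> b (R.par \<C> E),
       a (R.par \<C> E) [^]\<^bsub>mult_monoid A\<^esub> n) \<in> R.q E)"
    using rlat_cong_inf_iff c pow_closed by (simp cong: ball_cong)
  finally show ?thesis .
qed

section \<open>The map on families induced by \<open>lam\<close>\<close>

definition hull_map :: "'a set set \<Rightarrow> ('a set \<Rightarrow> 'a) \<Rightarrow> ('b set set \<times> ('b set \<Rightarrow> 'b set)) set" where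
  "hull_map \<C> a = L.H.el ((`) lam ` \<C>) (\<lambda>K. lam (a (pre K)))"

lemma pre_lam_partition: "\<lbrakk>\<C> \<in> partitions A; C \<in> \<C>\<rbrakk> \<Longrightarrow> pre (lam ` C) = C"
  using pre_lam_image partition_memD(1) by blast

lemma hull_map_family:
  "\<lbrakk>\<C> \<in> partitions A; a \<in> \<C> \<rightarrow> carrier A\<rbrakk>
    \<Longrightarrow> (\<lambda>K. lam (a (pre K))) \<in> (`) lam ` \<C> \<rightarrow> carrier L"
  using pre_lam_partition lam_closed by (auto simp: Pi_iff)

text \<open>Every partition of \<open>L\<close> is an image partition, so the refinement witnessing
  equality may be taken as an image; there the congruence splits into two instances of
  \<open>hull_le\<close>.\<close>

lemma hull_map_eq_iff:
  assumes C: "\<C> \<in> partitions A" and a: "a \<in> \<C> \<rightarrow> carrier A" and b: "b \<in> \<C> \<rightarrow> carrier A"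
  shows "hull_map \<C> a = hull_map \<C> b \<longleftrightarrow>
    (\<exists>\<E>\<in>partitions A. refined_by \<C> \<E> \<and> hull_le \<C> a b \<E> \<and> hull_le \<C> b a \<E>)"
proof -
  let ?Q = "\<lambda>\<K>. refined_by ((`) lam ` \<C>) \<K> \<and>
    (\<forall>K\<in>\<K>. (lam (a (pre (L.H.par ((`) lam ` \<C>) K))), lam (b (pre (L.H.par ((`) lam ` \<C>) K)))) \<in> L.H.q K)"
  have Q: "?Q ((`) lam ` \<E>) \<longleftrightarrow> refined_by \<C> \<E> \<and> hull_le \<C> a b \<E> \<and> hull_le \<C> b a \<E>"
    if E: "\<E> \<in> partitions A" for \<E>
  proof (cases "refined_by \<C> \<E>")
    case True
    have "(lam (a (pre (L.H.par ((`) lam ` \<C>) (lam ` E)))),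
          lam (b (pre (L.H.par ((`) lam ` \<C>) (lam ` E))))) \<in> L.H.q (lam ` E) \<longleftrightarrow>
        (\<exists>k\<in>coann L (lam ` E). lam (a (R.par \<C> E)) \<sqinter>\<^bsub>L\<^esub> k \<preceq>\<^bsub>L\<^esub> lam (b (R.par \<C> E))) \<and>
        (\<exists>k\<in>coann L (lam ` E). lam (b (R.par \<C> E)) \<sqinter>\<^bsub>L\<^esub> k \<preceq>\<^bsub>L\<^esub> lam (a (R.par \<C> E)))"
      if "E \<in> \<E>" for E
    proof -
      have p: "R.par \<C> E \<in> \<C>" using R.par_mem(1)[OF C E True that] .
      then have "lam (a (R.par \<C> E)) \<in> carrier L" "lam (b (R.par \<C> E)) \<in> carrier L"
        using a b lam_closed by auto
      moreover have "lam ` E \<subseteq> carrier L" using partition_memD(2)[OF E that] lam_closed by blast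
      moreover have "pre (L.H.par ((`) lam ` \<C>) (lam ` E)) = R.par \<C> E"
        using lam_par[OF C E True that] pre_lam_partition[OF C p] by simp
      ultimately show ?thesis using L.lat_cong_coann_iff2 by simp
    qed
    then show ?thesis using True lam_refined_iff[OF C E] unfolding hull_le_def by auto
  next
    case False
    then show ?thesis using lam_refined_iff[OF C E] by simp
  qed
  have "hull_map \<C> a = hull_map \<C> b \<longleftrightarrow> (\<exists>\<K>\<in>partitions L. ?Q \<K>)"
    unfolding hull_map_def
    by (rule L.H.el_eq_iff_stage[OF lam_partition[OF C] hull_map_family[OF C a] hull_map_family[OF C b]])
  also have "\<dots> \<longleftrightarrow> (\<exists>\<E>\<in>partitions A. ?Q ((`) lam ` \<E>))"
    by (rule iffI) (metis partition_eq_lam_image, metis lam_partition)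
  finally show ?thesis using Q by blast
qed

text \<open>Compatibility with the transition maps holds because, by \<open>lam_par\<close>, parents
  among images are images of parents.\<close>

lemma hull_map_refine:
  assumes "\<C> \<in> partitions A" "a \<in> \<C> \<rightarrow> carrier A" "\<E> \<in> partitions A" "refined_by \<C> \<E>"
  shows "hull_map \<C> a = hull_map \<E> (\<lambda>E. a (R.par \<C> E))"
proof -
  have "hull_map \<C> a = L.H.el ((`) lam ` \<E>) (\<lambda>K. lam (a (pre (L.H.par ((`) lam ` \<C>) K))))"
    unfolding hull_map_def
    using L.H.el_refine[OF lam_partition hull_map_family lam_partition] lam_refined_iff assms by simp
  also have "\<dots> = hull_map \<E> (\<lambda>E. a (R.par \<C> E))"
    unfolding hull_map_def
  proof (rule L.H.el_cong)
    fix K assume "K \<in> (`) lam ` \<E>"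
    then obtain E where E: "E \<in> \<E>" "K = lam ` E" by blast
    then show "lam (a (pre (L.H.par ((`) lam ` \<C>) K))) = lam (a (R.par \<C> (pre K)))"
      using lam_par[OF assms(1,3,4)] R.par_mem(1)[OF assms(1,3,4)]
        pre_lam_partition[OF assms(1)] pre_lam_partition[OF assms(3)] by simp
  qed
  finally show ?thesis .
qed

text \<open>Surjectivity of the comparison: the partition is lifted by preimages and the values by
  surjectivity of \<open>lam\<close>.\<close>

lemma carrier_lat_hull_reticulation:
  "carrier (lat_hull L) = {hull_map \<C> a | \<C> a. \<C> \<in> partitions A \<and> a \<in> \<C> \<rightarrow> carrier A}"
proof (intro equalityI subsetI)
  fix X assume "X \<in> carrier (lat_hull L)"
  then obtain \<K> f where K: "\<K> \<in> partitions L" "f \<in> \<K> \<rightarrow> carrier L" "X = L.H.el \<K> f"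
    unfolding L.carrier_lat_hull by blast
  obtain \<C> where C: "\<C> \<in> partitions A" "\<K> = (`) lam ` \<C>" using partition_eq_lam_image[OF K(1)] .
  have "\<forall>C\<in>\<C>. \<exists>x\<in>carrier A. lam x = f (lam ` C)"
    using K(2) C(2) surj by (metis (no_types, lifting) PiE image_iff)
  then obtain a where a: "\<forall>C\<in>\<C>. a C \<in> carrier A \<and> lam (a C) = f (lam ` C)" by metis
  have "X = hull_map \<C> a"
    unfolding K(3) C(2) hull_map_def
    using a pre_lam_partition[OF C(1)] by (intro L.H.el_cong) auto
  then show "X \<in> {hull_map \<C> a | \<C> a. \<C> \<in> partitions A \<and> a \<in> \<C> \<rightarrow> carrier A}"
    using C(1) a by blast
next
  fix X assume "X \<in> {hull_map \<C> a | \<C> a. \<C> \<in> partitions A \<and> a \<in> \<C> \<rightarrow> carrier A}"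
  then show "X \<in> carrier (lat_hull L)"
    unfolding L.carrier_lat_hull hull_map_def using lam_partition hull_map_family by blast
qed

lemma hull_map_sup:
  assumes C: "\<C> \<in> partitions A" and a: "a \<in> \<C> \<rightarrow> carrier A" and b: "b \<in> \<C> \<rightarrow> carrier A"
  shows "hull_map \<C> (\<lambda>C. a C \<squnion> b C) = hull_map \<C> a \<squnion>\<^bsub>lat_hull L\<^esub> hull_map \<C> b"
proof -
  have "hull_map \<C> a \<squnion>\<^bsub>lat_hull L\<^esub> hull_map \<C> b =
      L.H.el ((`) lam ` \<C>) (\<lambda>K. lam (a (pre K)) \<squnion>\<^bsub>L\<^esub> lam (b (pre K)))"
    unfolding hull_map_def using L.lat_hull_sup lam_partition hull_map_family assms by simp
  also have "\<dots> = hull_map \<C> (\<lambda>C. a C \<squnion> b C)"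
    unfolding hull_map_def
  proof (rule L.H.el_cong)
    fix K assume "K \<in> (`) lam ` \<C>"
    then have "pre K \<in> \<C>" using pre_lam_partition[OF C] by auto
    then show "lam (a (pre K)) \<squnion>\<^bsub>L\<^esub> lam (b (pre K)) = lam (a (pre K) \<squnion> b (pre K))"
      using map_sup a b by (metis PiE)
  qed
  finally show ?thesis ..
qed

lemma hull_map_mult:
  assumes C: "\<C> \<in> partitions A" and a: "a \<in> \<C> \<rightarrow> carrier A" and b: "b \<in> \<C> \<rightarrow> carrier A"
  shows "hull_map \<C> (\<lambda>C. a C \<odot> b C) = hull_map \<C> a \<sqinter>\<^bsub>lat_hull L\<^esub> hull_map \<C> b"
proof -
  have "hull_map \<C> a \<sqinter>\<^bsub>lat_hull L\<^esub> hull_map \<C> b =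
      L.H.el ((`) lam ` \<C>) (\<lambda>K. lam (a (pre K)) \<sqinter>\<^bsub>L\<^esub> lam (b (pre K)))"
    unfolding hull_map_def using L.lat_hull_inf lam_partition hull_map_family assms by simp
  also have "\<dots> = hull_map \<C> (\<lambda>C. a C \<odot> b C)"
    unfolding hull_map_def
  proof (rule L.H.el_cong)
    fix K assume "K \<in> (`) lam ` \<C>"
    then have "pre K \<in> \<C>" using pre_lam_partition[OF C] by auto
    then show "lam (a (pre K)) \<sqinter>\<^bsub>L\<^esub> lam (b (pre K)) = lam (a (pre K) \<odot> b (pre K))"
      using map_mult a b by (metis PiE)
  qed
  finally show ?thesis ..
qed

lemma hull_map_zero: "\<C> \<in> partitions A \<Longrightarrow> hull_map \<C> (\<lambda>_. lzero A) = lzero (lat_hull L)"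
  unfolding hull_map_def using L.lat_hull_zero[OF lam_partition, of \<C>] by (simp add: map_zero)

lemma hull_map_one: "\<C> \<in> partitions A \<Longrightarrow> hull_map \<C> (\<lambda>_. lone A) = lone (lat_hull L)"
  unfolding hull_map_def using L.lat_hull_one[OF lam_partition, of \<C>] by (simp add: map_one)

text \<open>An inequality between a power and an element of the hull provides an exponent and a
  stage; at that stage \<open>hull_le_iff\<close> absorbs the exponent.\<close>

lemma reticulation_hull_le_iff:
  assumes ret: "reticulation (rlat_hull A) L' lam'"
    and C: "\<C> \<in> partitions A" and a: "a \<in> \<C> \<rightarrow> carrier A" and b: "b \<in> \<C> \<rightarrow> carrier A"
  shows "lam' (R.el \<C> a) \<preceq>\<^bsub>L'\<^esub> lam' (R.el \<C> b) \<longleftrightarrow>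
    (\<exists>\<E>\<in>partitions A. refined_by \<C> \<E> \<and> hull_le \<C> a b \<E>)"
proof -
  interpret H: reticulation "rlat_hull A" L' lam' by (rule ret)
  have mem: "R.el \<C> a \<in> carrier (rlat_hull A)" "R.el \<C> b \<in> carrier (rlat_hull A)"
    using C a b unfolding carrier_rlat_hull by blast+
  have le: "R.el \<C> a [^]\<^bsub>mult_monoid (rlat_hull A)\<^esub> n \<preceq>\<^bsub>rlat_hull A\<^esub> R.el \<C> b \<longleftrightarrow>
      (\<exists>\<E>\<in>partitions A. refined_by \<C> \<E> \<and>
        (\<forall>E\<in>\<E>. (a (R.par \<C> E) [^]\<^bsub>mult_monoid A\<^esub> n \<sqinter> b (R.par \<C> E),
          a (R.par \<C> E) [^]\<^bsub>mult_monoid A\<^esub> n) \<in> R.q E))" for n :: nat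
  proof -
    have p: "(\<lambda>C. a C [^]\<^bsub>mult_monoid A\<^esub> n) \<in> \<C> \<rightarrow> carrier A"
      using a pow_closed by (auto simp: Pi_iff)
    have i: "(\<lambda>C. a C [^]\<^bsub>mult_monoid A\<^esub> n \<sqinter> b C) \<in> \<C> \<rightarrow> carrier A"
      using p b inf_closed by (auto simp: Pi_iff)
    show ?thesis
      unfolding lat_le_def rlat_hull_pow[OF C a] rlat_hull_inf[OF C p b]
      by (rule R.el_eq_iff_stage[OF C i p])
  qed
  show ?thesis
    unfolding H.map_le_iff[OF mem] le using hull_le_iff[OF C a b] by blast
qed

text \<open>The two inequalities may hold at different stages; \<open>hull_le_refine\<close> carries
  both to a common refinement.\<close>

lemma reticulation_hull_eq_iff:
  assumes ret: "reticulation (rlat_hull A) L' lam'"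
    and C: "\<C> \<in> partitions A" and a: "a \<in> \<C> \<rightarrow> carrier A" and b: "b \<in> \<C> \<rightarrow> carrier A"
  shows "lam' (R.el \<C> a) = lam' (R.el \<C> b) \<longleftrightarrow> hull_map \<C> a = hull_map \<C> b"
proof -
  interpret H: reticulation "rlat_hull A" L' lam' by (rule ret)
  have "lam' (R.el \<C> a) \<in> carrier L'" "lam' (R.el \<C> b) \<in> carrier L'"
    using C a b H.surj unfolding carrier_rlat_hull by blast+
  then have "lam' (R.el \<C> a) = lam' (R.el \<C> b) \<longleftrightarrow>
      lam' (R.el \<C> a) \<preceq>\<^bsub>L'\<^esub> lam' (R.el \<C> b) \<and> lam' (R.el \<C> b) \<preceq>\<^bsub>L'\<^esub> lam' (R.el \<C> a)"
    using H.L.le_antisym H.L.le_refl by metis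
  also have "\<dots> \<longleftrightarrow> (\<exists>\<E>\<in>partitions A. refined_by \<C> \<E> \<and> hull_le \<C> a b \<E> \<and> hull_le \<C> b a \<E>)"
    unfolding reticulation_hull_le_iff[OF ret C a b] reticulation_hull_le_iff[OF ret C b a]
  proof (intro iffI; elim conjE bexE)
    fix \<E> \<F> assume E: "\<E> \<in> partitions A" "refined_by \<C> \<E>" "hull_le \<C> a b \<E>"
      and F: "\<F> \<in> partitions A" "refined_by \<C> \<F>" "hull_le \<C> b a \<F>"
    obtain \<G> where G: "\<G> \<in> partitions A" "refined_by \<E> \<G>" "refined_by \<F> \<G>"
      using partitions_directed[OF E(1) F(1)] .
    have "hull_le \<C> a b \<G>" "hull_le \<C> b a \<G>"
      using hull_le_refine[OF E(3,2) G(2) C E(1) G(1)] hull_le_refine[OF F(3,2) G(3) C F(1) G(1)] .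
    then show "\<exists>\<E>\<in>partitions A. refined_by \<C> \<E> \<and> hull_le \<C> a b \<E> \<and> hull_le \<C> b a \<E>"
      using G(1) refined_by_trans[OF E(2) G(2)] by blast
  qed blast
  also have "\<dots> \<longleftrightarrow> hull_map \<C> a = hull_map \<C> b" using hull_map_eq_iff[OF C a b] by simp
  finally show ?thesis .
qed

end

text \<open>The map \<open>h\<close> picks a preimage under \<open>u\<close> and applies
  \<open>v\<close>; equal kernels make the choice irrelevant and \<open>h\<close> injective.\<close>

lemma bij_betw_of_same_kernel:
  assumes "\<And>p q. \<lbrakk>p \<in> P; q \<in> P\<rbrakk> \<Longrightarrow> u p = u q \<longleftrightarrow> v p = v q"
  obtains h where "bij_betw h (u ` P) (v ` P)" "\<And>p. p \<in> P \<Longrightarrow> h (u p) = v p"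
proof
  let ?h = "v \<circ> inv_into P u"
  show h: "?h (u p) = v p" if "p \<in> P" for p
    using assms[of "inv_into P u (u p)" p] that by (simp add: inv_into_into f_inv_into_f)
  have "inj_on ?h (u ` P)"
  proof (rule inj_onI)
    fix x y assume "x \<in> u ` P" "y \<in> u ` P" and eq: "?h x = ?h y"
    then obtain p q where "p \<in> P" "x = u p" "q \<in> P" "y = u q" by blast
    then show "x = y" using eq h[of p] h[of q] assms[of p q] by simp
  qed
  moreover have "?h ` u ` P = v ` P"
    unfolding image_image using h by (intro image_cong) simp_all
  ultimately show "bij_betw ?h (u ` P) (v ` P)" unfolding bij_betw_def ..
qed

theorem proposition4p11:
  fixes A :: "'a rlat"
    and L :: "'b lat" and lam :: "'a \<Rightarrow> 'b"
    and L' :: "'c lat" and lam' :: "('a set set \<times> ('a set \<Rightarrow> 'a set)) set \<Rightarrow> 'c"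
  assumes "residuated_lattice A"
    and "reticulation A L lam"
    and "reticulation (rlat_hull A) L' lam'"
  shows "isomorphic_bounded_lattices L' (lat_hull L)"
proof -
  interpret reticulated_lattice A L lam
    using assms(1,2) by (rule reticulated_lattice.intro)
  interpret H: reticulation "rlat_hull A" L' lam' by (rule assms(3))
  \<comment> \<open>Pairs of a partition and a family parametrise both \<open>L'\<close> and the
    hull of \<open>L\<close>, so the isomorphism comes from comparing two kernels on one
    set.\<close>
  let ?P = "SIGMA \<C>:partitions A. \<C> \<rightarrow> carrier A"
  let ?u = "\<lambda>(\<C>, a). lam' (R.el \<C> a)" and ?v = "\<lambda>(\<C>, a). hull_map \<C> a"
  have "carrier (rlat_hull A) = (\<lambda>(\<C>, a). R.el \<C> a) ` ?P"
    unfolding carrier_rlat_hull by auto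
  then have u: "?u ` ?P = carrier L'"
    unfolding H.surj[symmetric] by (simp add: image_image case_prod_unfold)
  have v: "?v ` ?P = carrier (lat_hull L)"
    unfolding carrier_lat_hull_reticulation by auto
  \<comment> \<open>Kernels are compared within one partition, so two pairs are first moved to a
    common one, on both sides at once.\<close>
  have stage: "\<exists>\<E> a' b'. \<E> \<in> partitions A \<and> a' \<in> \<E> \<rightarrow> carrier A \<and> b' \<in> \<E> \<rightarrow> carrier A \<and>
      R.el \<C> a = R.el \<E> a' \<and> R.el \<D> b = R.el \<E> b' \<and>
      hull_map \<C> a = hull_map \<E> a' \<and> hull_map \<D> b = hull_map \<E> b'"
    if "\<C> \<in> partitions A" "a \<in> \<C> \<rightarrow> carrier A" "\<D> \<in> partitions A" "b \<in> \<D> \<rightarrow> carrier A" for \<C> \<D> a b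
    by (rule R.el_common_stage[OF that]) (use hull_map_refine that in metis)
  have uv: "?u p = ?u q \<longleftrightarrow> ?v p = ?v q" if "p \<in> ?P" "q \<in> ?P" for p q
  proof -
    obtain \<C> a \<D> b where "p = (\<C>, a)" "q = (\<D>, b)" by (cases p, cases q)
    then show ?thesis
      using stage[of \<C> a \<D> b] that reticulation_hull_eq_iff[OF assms(3)] by auto
  qed
  obtain h where bij: "bij_betw h (carrier L') (carrier (lat_hull L))"
    and huv: "\<And>p. p \<in> ?P \<Longrightarrow> h (?u p) = ?v p"
    using bij_betw_of_same_kernel[of ?P ?u ?v, OF uv] unfolding u v by metis
  have h: "h (lam' (R.el \<C> a)) = hull_map \<C> a" if "\<C> \<in> partitions A" "a \<in> \<C> \<rightarrow> carrier A" for \<C> a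
    using huv[of "(\<C>, a)"] that by simp
  have hop: "h (x \<squnion>\<^bsub>L'\<^esub> y) = h x \<squnion>\<^bsub>lat_hull L\<^esub> h y \<and> h (x \<sqinter>\<^bsub>L'\<^esub> y) = h x \<sqinter>\<^bsub>lat_hull L\<^esub> h y"
    if x: "x \<in> carrier L'" and y: "y \<in> carrier L'" for x y
  proof -
    obtain \<C> a \<D> b where "\<C> \<in> partitions A" "a \<in> \<C> \<rightarrow> carrier A" "x = lam' (R.el \<C> a)"
      "\<D> \<in> partitions A" "b \<in> \<D> \<rightarrow> carrier A" "y = lam' (R.el \<D> b)"
      using x y unfolding u[symmetric] by auto
    then obtain \<E> a' b' where E: "\<E> \<in> partitions A" and a': "a' \<in> \<E> \<rightarrow> carrier A"
      and b': "b' \<in> \<E> \<rightarrow> carrier A" and xy: "x = lam' (R.el \<E> a')" "y = lam' (R.el \<E> b')"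
      using stage[of \<C> a \<D> b] by metis
    have mem: "R.el \<E> a' \<in> carrier (rlat_hull A)" "R.el \<E> b' \<in> carrier (rlat_hull A)"
      using E a' b' unfolding carrier_rlat_hull by blast+
    \<comment> \<open>Meets in \<open>L'\<close> are realised by products of representatives, since
      \<open>lam'\<close> sends products in the hull to meets.\<close>
    have c: "(\<lambda>C. a' C \<squnion>\<^bsub>A\<^esub> b' C) \<in> \<E> \<rightarrow> carrier A" "(\<lambda>C. a' C \<odot>\<^bsub>A\<^esub> b' C) \<in> \<E> \<rightarrow> carrier A"
      using a' b' sup_closed mult_closed by (auto simp: Pi_iff)
    have "x \<squnion>\<^bsub>L'\<^esub> y = lam' (R.el \<E> (\<lambda>C. a' C \<squnion>\<^bsub>A\<^esub> b' C))"
      "x \<sqinter>\<^bsub>L'\<^esub> y = lam' (R.el \<E> (\<lambda>C. a' C \<odot>\<^bsub>A\<^esub> b' C))"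
      unfolding xy using H.map_sup[OF mem] H.map_mult[OF mem]
        rlat_hull_sup[OF E a' b'] rlat_hull_mult[OF E a' b'] by simp_all
    then show ?thesis
      using h[OF E c(1)] h[OF E c(2)] h[OF E a'] h[OF E b'] xy
        hull_map_sup[OF E a' b'] hull_map_mult[OF E a' b'] by simp
  qed
  \<comment> \<open>A stage at which to evaluate the constants exists because 0 of \<open>L'\<close>
    is the image of some pair.\<close>
  obtain \<C> where C: "\<C> \<in> partitions A"
    using H.L.zero_closed unfolding u[symmetric] by auto
  have "h (lzero L') = lzero (lat_hull L)" "h (lone L') = lone (lat_hull L)"
    using h[OF C, of "\<lambda>_. lzero A"] h[OF C, of "\<lambda>_. lone A"] zero_closed one_closed
      H.map_zero H.map_one rlat_hull_zero[OF C] rlat_hull_one[OF C]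
      hull_map_zero[OF C] hull_map_one[OF C] by simp_all
  then have "h \<in> lat_iso L' (lat_hull L)"
    unfolding lat_iso_def using bij hop by blast
  then show ?thesis unfolding isomorphic_bounded_lattices_def by blast
qed

end
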